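(* Assume the standing setting below, and assume in addition that $D(A_2)\subset D(A_1^{1/2})$ and there is $c>0$ with $|A_1^{1/2}u|\le c|A_2u|$ for all $u\in D(A_2)$. Let $n\ge1$ be an integer and $0<\theta<1$. Then there is a constant $c_{n,\theta}>0$ such that for every $U_0\in(\mathcal H,D(\mathcal A^{4n}))_{\theta,2}$ the solution $U(t)=e^{t\mathcal A}U_0$ satisfies $$\|U(t)\|_{\mathcal H}^2\le\frac{c_{n,\theta}}{t^{n\theta}}\|U_0\|^2_{(\mathcal H,D(\mathcal A^{4n}))_{\theta,2}}\qquad\forall t>0.$$
   Context: Standing setting: $H$ is a real Hilbert space with inner product $\langle\cdot,\cdot\rangle$ and norm $|\cdot|$. $A_1,A_2$ are densely defined closed self-adjoint operators on $H$ with $\langle A_iu,u\rangle\ge\omega_i|u|^2$ for $u\in D(A_i)$, for some $\omega_1,\omega_2>0$; $A_i^{s}$ denote their fractional powers. $B$ is a bounded self-adjoint operator on $H$ with $\langle Bu,u\rangle\ge\beta|u|^2$ for all $u\in H$, for some $\beta>0$. $\alpha\in\mathbb R$ satisfies $0<|\alpha|<\sqrt{\omega_1\omega_2}$. Let $\mathcal H=D(A_1^{1/2})\times H\times D(A_2^{1/2})\times H$ with the inner product $(U|\widehat U)=\langle A_1^{1/2}u,A_1^{1/2}\widehat u\rangle+\langle p,\widehat p\rangle+\langle A_2^{1/2}v,A_2^{1/2}\widehat v\rangle+\langle q,\widehat q\rangle+\alpha\langle u,\widehat v\rangle+\alpha\langle v,\widehat u\rangle$ for $U=(u,p,v,q)$,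 and norm $\|U\|_{\mathcal H}=(U|U)^{1/2}$. Define $\mathcal A$ on $D(\mathcal A)=D(A_1)\times D(A_1^{1/2})\times D(A_2)\times D(A_2^{1/2})$ by $\mathcal AU=(p,-A_1u-Bp-\alpha v,q,-A_2v-\alpha u)$; it generates a $C_0$-semigroup of contractions $e^{t\mathcal A}$ on $\mathcal H$, corresponding to the system $u''+A_1u+Bu'+\alpha v=0$, $v''+A_2v+\alpha u=0$. $D(\mathcal A^k)$ carries the graph norm $\|U\|^2_{D(\mathcal A^k)}=\sum_{i=0}^k\|\mathcal A^iU\|^2_{\mathcal H}$. Real interpolation: for Banach spaces $D\hookrightarrow X$, $x\in X$, $t>0$, let $K(t,x)=\inf\{|a|_X+t|b|_D: x=a+b,\ a\in X,\ b\in D\}$; $(X,D)_{\theta,2}=\{x\in X:\int_0^\infty (t^{-\theta-1/2}K(t,x))^2dt<\infty\}$ with norm $|x|_{\theta,2}=\big(\int_0^\infty (t^{-\theta-1/2}K(t,x))^2dt\big)^{1/2}$. *)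

theory Defs
  imports "HOL-Analysis.Analysis"
begin

text \<open>An (unbounded) operator is represented by a domain D and a function f (values outside D irrelevant).\<close>

definition lin_op :: "'a::real_vector set \<Rightarrow> ('a \<Rightarrow> 'a) \<Rightarrow> bool" where
  "lin_op D f \<longleftrightarrow> subspace D \<and> (\<forall>x\<in>D. \<forall>y\<in>D. f (x + y) = f x + f y)
     \<and> (\<forall>c. \<forall>x\<in>D. f (c *\<^sub>R x) = c *\<^sub>R f x)"

definition closed_op :: "'a::real_normed_vector set \<Rightarrow> ('a \<Rightarrow> 'a) \<Rightarrow> bool" where
  "closed_op D f \<longleftrightarrow> closed {(x, f x) | x. x \<in> D}"

text \<open>T = T*: T symmetric and the domain of the adjoint is contained in D.\<close>
definition self_adjoint_op :: "'a::real_inner set \<Rightarrow> ('a \<Rightarrow> 'a) \<Rightarrow> bool" where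
  "self_adjoint_op D f \<longleftrightarrow> (\<forall>u\<in>D. \<forall>v\<in>D. inner (f u) v = inner u (f v))
     \<and> (\<forall>v w. (\<forall>u\<in>D. inner (f u) v = inner u w) \<longrightarrow> v \<in> D \<and> w = f v)"

definition dcsa_op :: "'a::real_inner set \<Rightarrow> ('a \<Rightarrow> 'a) \<Rightarrow> bool" where
  "dcsa_op D f \<longleftrightarrow> lin_op D f \<and> closure D = UNIV \<and> closed_op D f \<and> self_adjoint_op D f"

text \<open>(DS, s) is the fractional power A^(1/2) of A = (DA, fA): the (unique) nonnegative
  self-adjoint operator whose square is A (including equality of domains).\<close>
definition is_sqrt_op :: "'a::real_inner set \<Rightarrow> ('a \<Rightarrow> 'a) \<Rightarrow> 'a set \<Rightarrow> ('a \<Rightarrow> 'a) \<Rightarrow> bool" where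
  "is_sqrt_op DA fA DS s \<longleftrightarrow> dcsa_op DS s \<and> (\<forall>u\<in>DS. inner (s u) u \<ge> 0)
     \<and> DA = {u \<in> DS. s u \<in> DS} \<and> (\<forall>u\<in>DA. fA u = s (s u))"

definition Hcar :: "'a set \<Rightarrow> 'a set \<Rightarrow> ('a \<times> 'a \<times> 'a \<times> 'a) set" where
  "Hcar DS1 DS2 = DS1 \<times> UNIV \<times> DS2 \<times> UNIV"

definition hinner :: "('a::real_inner \<Rightarrow> 'a) \<Rightarrow> ('a \<Rightarrow> 'a) \<Rightarrow> real
     \<Rightarrow> 'a \<times> 'a \<times> 'a \<times> 'a \<Rightarrow> 'a \<times> 'a \<times> 'a \<times> 'a \<Rightarrow> real" where
  "hinner s1 s2 \<alpha> U V = (case U of (u, p, v, q) \<Rightarrow> case V of (u', p', v', q') \<Rightarrow>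
      inner (s1 u) (s1 u') + inner p p' + inner (s2 v) (s2 v') + inner q q'
      + \<alpha> * inner u v' + \<alpha> * inner v u')"

definition hnorm :: "('a::real_inner \<Rightarrow> 'a) \<Rightarrow> ('a \<Rightarrow> 'a) \<Rightarrow> real \<Rightarrow> 'a \<times> 'a \<times> 'a \<times> 'a \<Rightarrow> real" where
  "hnorm s1 s2 \<alpha> U = sqrt (hinner s1 s2 \<alpha> U U)"

definition DopA :: "'a set \<Rightarrow> 'a set \<Rightarrow> 'a set \<Rightarrow> 'a set \<Rightarrow> ('a \<times> 'a \<times> 'a \<times> 'a) set" where
  "DopA DA1 DS1 DA2 DS2 = DA1 \<times> DS1 \<times> DA2 \<times> DS2"

definition opA :: "('a::real_vector \<Rightarrow> 'a) \<Rightarrow> ('a \<Rightarrow> 'a) \<Rightarrow> ('a \<Rightarrow> 'a) \<Rightarrow> real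
     \<Rightarrow> 'a \<times> 'a \<times> 'a \<times> 'a \<Rightarrow> 'a \<times> 'a \<times> 'a \<times> 'a" where
  "opA f1 f2 B \<alpha> U = (case U of (u, p, v, q) \<Rightarrow>
      (p, - f1 u - B p - \<alpha> *\<^sub>R v, q, - f2 v - \<alpha> *\<^sub>R u))"

definition is_C0_semigroup_gen :: "('b::real_vector \<Rightarrow> real) \<Rightarrow> 'b set \<Rightarrow> 'b set \<Rightarrow> ('b \<Rightarrow> 'b)
     \<Rightarrow> (real \<Rightarrow> 'b \<Rightarrow> 'b) \<Rightarrow> bool" where
  "is_C0_semigroup_gen nm X Dm F T \<longleftrightarrow>
     (\<forall>t\<ge>0. \<forall>U\<in>X. T t U \<in> X) \<and>
     (\<forall>t\<ge>0. \<forall>U\<in>X. \<forall>V\<in>X. T t (U + V) = T t U + T t V) \<and>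
     (\<forall>t\<ge>0. \<forall>c. \<forall>U\<in>X. T t (c *\<^sub>R U) = c *\<^sub>R T t U) \<and>
     (\<forall>t\<ge>0. \<forall>U\<in>X. nm (T t U) \<le> nm U) \<and>
     (\<forall>U\<in>X. T 0 U = U) \<and>
     (\<forall>t\<ge>0. \<forall>s\<ge>0. \<forall>U\<in>X. T (t + s) U = T t (T s U)) \<and>
     (\<forall>U\<in>X. \<forall>t0\<ge>0. \<forall>e>0. \<exists>d>0. \<forall>t\<ge>0. \<bar>t - t0\<bar> < d \<longrightarrow> nm (T t U - T t0 U) < e) \<and>
     (\<forall>U\<in>X. \<forall>W\<in>X.
        (((\<lambda>h. nm ((1 / h) *\<^sub>R (T h U - U) - W)) \<longlongrightarrow> 0) (at_right 0))
        \<longleftrightarrow> (U \<in> Dm \<and> W = F U))"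

primrec dom_pow :: "'b set \<Rightarrow> 'b set \<Rightarrow> ('b \<Rightarrow> 'b) \<Rightarrow> nat \<Rightarrow> 'b set" where
  "dom_pow X Dm F 0 = X"
| "dom_pow X Dm F (Suc k) = {U \<in> Dm. F U \<in> dom_pow X Dm F k}"

definition graph_norm :: "('b \<Rightarrow> real) \<Rightarrow> ('b \<Rightarrow> 'b) \<Rightarrow> nat \<Rightarrow> 'b \<Rightarrow> real" where
  "graph_norm nm F k U = sqrt (\<Sum>i\<le>k. (nm ((F ^^ i) U))\<^sup>2)"

definition Kfun :: "('b::plus \<Rightarrow> real) \<Rightarrow> 'b set \<Rightarrow> ('b \<Rightarrow> real) \<Rightarrow> 'b set \<Rightarrow> real \<Rightarrow> 'b \<Rightarrow> real" where
  "Kfun nX X nD D t x = Inf {nX a + t * nD b | a b. a \<in> X \<and> b \<in> D \<and> x = a + b}"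

definition interp_int :: "('b::plus \<Rightarrow> real) \<Rightarrow> 'b set \<Rightarrow> ('b \<Rightarrow> real) \<Rightarrow> 'b set \<Rightarrow> real \<Rightarrow> 'b \<Rightarrow> ennreal" where
  "interp_int nX X nD D \<theta> x =
     (\<integral>\<^sup>+ t \<in> {0<..}. ennreal ((t powr (- \<theta> - 1/2) * Kfun nX X nD D t x)\<^sup>2) \<partial>lborel)"

definition interp_space :: "('b::plus \<Rightarrow> real) \<Rightarrow> 'b set \<Rightarrow> ('b \<Rightarrow> real) \<Rightarrow> 'b set \<Rightarrow> real \<Rightarrow> 'b set" where
  "interp_space nX X nD D \<theta> = {x \<in> X. interp_int nX X nD D \<theta> x < \<infinity>}"

definition interp_norm :: "('b::plus \<Rightarrow> real) \<Rightarrow> 'b set \<Rightarrow> ('b \<Rightarrow> real) \<Rightarrow> 'b set \<Rightarrow> real \<Rightarrow> 'b \<Rightarrow> real" where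
  "interp_norm nX X nD D \<theta> x = sqrt (enn2real (interp_int nX X nD D \<theta> x))"

end

(* Let U be a solution with data in D(A^4), let u_k, v_k denote the k-th time derivatives of u, v,
   and let E(U) = ||U||^2. Dissipation of E(A^k U) controls u_1, ..., u_5 in L^2(0, oo). Testing
   alpha v_3 = - u_5 - A1 u_3 - B u_4 against A2^(-1) v_1 and using that A1^(1/2) A2^(-1) is bounded
   gives |v_1| <= C (|u_5| + |u_4| + |u_1| + |A1^(1/2) u_3|). Testing the same equation against u_3
   controls A1^(1/2) u_3 up to the product of v_3 and u_3, which after two integrations by parts in
   time becomes that of v_1 and u_5 and is absorbed. Finally E equals 2 |u_1|^2 + 2 |v_1|^2 up to a
   time derivative. So a Lyapunov functional dominated by the energies of order 0, ..., 4 has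
   derivative at most - E, whence t E(U(t)) <= C (sum of these energies at time 0). Iterating over
   n subintervals gives the rate t^(-n) on D(A^(4n)). For interpolated data, splitting U0 = a + b
   bounds the K-functional at all s >= C t^(-n/2) from below by a multiple of ||U(t)||, and this
   tail alone already yields the factor t^(-n theta). *)

theory Submission
  imports Defs
begin

section \<open>Square roots of self-adjoint operators\<close>

text \<open>Two gaps have to be closed around this argument. The square roots are known only through
  their defining properties, and coercivity only on \<open>DA1\<close> and \<open>DA2\<close>,
  whereas the energy norm lives on \<open>DS1\<close> and \<open>DS2\<close>. Coercivity there and
  solvability of A2 y = v_1 both come from one variational problem, without spectral calculus.
  Moreover, U in D(A^4) puts A^4 U into the energy space but not into the domain of A, yet it is the
  dissipation of A^4 U that controls u_5; hence the energy identity is also proved for data that are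
  only in the range of the generator. The order 4 comes from the coupling: v_1 is seen through A2 in
  v_3 = - A2 v_1 - \<alpha> u_1, v_3 is seen in the equation for u_5, and u_5 is the first velocity
  of A^4 U. The products added to the energies contain derivatives of order at most 4, so they are
  bounded by energies; u_5 appears only when they are differentiated, where dissipation absorbs
  it.\<close>

lemma lin_op_simps:
  assumes "lin_op D f"
  shows "0 \<in> D" "\<And>x y. x \<in> D \<Longrightarrow> y \<in> D \<Longrightarrow> x + y \<in> D" "\<And>x y. x \<in> D \<Longrightarrow> y \<in> D \<Longrightarrow> x - y \<in> D"
    "\<And>r x. x \<in> D \<Longrightarrow> r *\<^sub>R x \<in> D" "f 0 = 0"
    "\<And>x y. x \<in> D \<Longrightarrow> y \<in> D \<Longrightarrow> f (x + y) = f x + f y"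
    "\<And>x y. x \<in> D \<Longrightarrow> y \<in> D \<Longrightarrow> f (x - y) = f x - f y"
    "\<And>r x. x \<in> D \<Longrightarrow> f (r *\<^sub>R x) = r *\<^sub>R f x"
proof -
  have sub: "subspace D" and add: "\<And>x y. x \<in> D \<Longrightarrow> y \<in> D \<Longrightarrow> f (x + y) = f x + f y"
    and scale: "\<And>r x. x \<in> D \<Longrightarrow> f (r *\<^sub>R x) = r *\<^sub>R f x"
    using assms by (auto simp: lin_op_def)
  show "0 \<in> D" "\<And>x y. x \<in> D \<Longrightarrow> y \<in> D \<Longrightarrow> x + y \<in> D" "\<And>x y. x \<in> D \<Longrightarrow> y \<in> D \<Longrightarrow> x - y \<in> D"
    "\<And>r x. x \<in> D \<Longrightarrow> r *\<^sub>R x \<in> D"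
    using sub by (auto simp: subspace_0 subspace_add subspace_diff subspace_scale)
  show "\<And>x y. x \<in> D \<Longrightarrow> y \<in> D \<Longrightarrow> f (x + y) = f x + f y" by (fact add)
  show "\<And>r x. x \<in> D \<Longrightarrow> f (r *\<^sub>R x) = r *\<^sub>R f x" by (fact scale)
  show "f 0 = 0" using scale[of 0 0] subspace_0[OF sub] by simp
  fix x y assume xy: "x \<in> D" "y \<in> D"
  have "f x = f (x - y) + f y"
    using add[of "x - y" y] xy sub by (simp add: subspace_diff)
  then show "f (x - y) = f x - f y" by simp
qed

lemma self_adjoint_sym: "dcsa_op D f \<Longrightarrow> u \<in> D \<Longrightarrow> v \<in> D \<Longrightarrow> inner (f u) v = inner u (f v)"
  unfolding dcsa_op_def self_adjoint_op_def by blast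

text \<open>Turns minimality along a line into the Euler-Lagrange equation. Testing with t = - b / k
  for some positive k >= q leaves - b^2 / k.\<close>

lemma nonneg_quadratic_linear_coeff_zero:
  fixes b q :: real
  assumes "\<And>t. 0 \<le> 2 * t * b + t\<^sup>2 * q"
  shows "b = 0"
proof (rule ccontr)
  assume b: "b \<noteq> 0"
  define k where "k = \<bar>q\<bar> + 1"
  have k: "k > 0" "q \<le> k" by (auto simp: k_def)
  have "0 \<le> 2 * (- b / k) * b + (- b / k)\<^sup>2 * q" by (rule assms)
  also have "\<dots> \<le> 2 * (- b / k) * b + (- b / k)\<^sup>2 * k"
    using k by (intro add_left_mono mult_left_mono) auto
  also have "\<dots> = - (b\<^sup>2 / k)" using k by (simp add: field_simps power2_eq_square)
  also have "\<dots> < 0" using k b by simp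
  finally show False by simp
qed

text \<open>The solution minimises \<open>|s y|\<^sup>2 + \<kappa> |y|\<^sup>2 - 2 \<langle>w, y\<rangle>\<close>; by the parallelogram identity
  minimising sequences are Cauchy in the graph norm.\<close>

lemma sqrt_op_shift_surj:
  fixes s :: "'a::{real_inner, complete_space} \<Rightarrow> 'a"
  assumes s: "dcsa_op D s" and m: "m > 0" and kap: "\<kappa> \<ge> 0"
    and coer: "\<And>y. y \<in> D \<Longrightarrow> m * (norm y)\<^sup>2 \<le> (norm (s y))\<^sup>2 + \<kappa> * (norm y)\<^sup>2"
  obtains y where "y \<in> D" "s y \<in> D" "s (s y) + \<kappa> *\<^sub>R y = w"
proof -
  have lin: "lin_op D s" and cl: "closed_op D s" and sa: "self_adjoint_op D s"
    using s by (auto simp: dcsa_op_def)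
  note L = lin_op_simps[OF lin]
  define q where "q = (\<lambda>y. (norm (s y))\<^sup>2 + \<kappa> * (norm y)\<^sup>2)"
  define J where "J = (\<lambda>y. q y - 2 * inner w y)"
  have Jlow: "- ((norm w)\<^sup>2 / m) \<le> J y" if "y \<in> D" for y
  proof -
    have "inner w y \<le> norm w * norm y" by (rule norm_cauchy_schwarz)
    moreover have "m * (norm y)\<^sup>2 \<le> q y" using coer[OF that] by (simp add: q_def)
    moreover have "0 \<le> (m * norm y - norm w)\<^sup>2 / m" using m by simp
    then have "0 \<le> m * (norm y)\<^sup>2 - 2 * (norm w * norm y) + (norm w)\<^sup>2 / m"
      using m by (simp add: field_simps power2_eq_square)
    ultimately show ?thesis by (simp add: J_def)
  qed
  define d where "d = Inf (J ` D)"
  have bdd: "bdd_below (J ` D)" using Jlow by (auto intro!: bdd_belowI)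
  have dle: "d \<le> J y" if "y \<in> D" for y
    unfolding d_def using that bdd by (auto intro: cInf_lower)
  have "\<exists>y\<in>D. J y < d + 1 / real (Suc k)" for k
  proof -
    have "Inf (J ` D) < d + 1 / real (Suc k)" by (simp add: d_def)
    then show ?thesis using cInf_less_iff[OF _ bdd] L(1) by auto
  qed
  then obtain Y where Y: "\<And>k. Y k \<in> D" "\<And>k. J (Y k) < d + 1 / real (Suc k)" by metis
  have par: "q (a - b) \<le> 2 * (J a - d) + 2 * (J b - d)" if "a \<in> D" "b \<in> D" for a b
  proof -
    have mid: "(1/2) *\<^sub>R (a + b) \<in> D" using that L by auto
    have "J ((1/2) *\<^sub>R (a + b)) = (1/4) * (norm (s a + s b))\<^sup>2 + \<kappa> * ((1/4) * (norm (a + b))\<^sup>2) - inner w (a + b)"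
      using that by (simp add: J_def q_def L power_mult_distrib power2_eq_square)
    moreover have "q (a - b) = (norm (s a - s b))\<^sup>2 + \<kappa> * (norm (a - b))\<^sup>2"
      using that by (simp add: q_def L)
    moreover have "(norm (s a - s b))\<^sup>2 + (norm (s a + s b))\<^sup>2 = 2 * (norm (s a))\<^sup>2 + 2 * (norm (s b))\<^sup>2"
      by (simp add: power2_norm_eq_inner algebra_simps inner_commute)
    moreover have "\<kappa> * (norm (a - b))\<^sup>2 + \<kappa> * (norm (a + b))\<^sup>2 = 2 * (\<kappa> * (norm a)\<^sup>2) + 2 * (\<kappa> * (norm b)\<^sup>2)"
      by (simp add: power2_norm_eq_inner algebra_simps inner_commute)
    ultimately have "q (a - b) = 2 * J a + 2 * J b - 4 * J ((1/2) *\<^sub>R (a + b))"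
      by (simp add: J_def q_def inner_add_right algebra_simps)
    then show ?thesis using dle[OF mid] by simp
  qed
  have qlow: "m * (norm z)\<^sup>2 \<le> q z" "(norm (s z))\<^sup>2 \<le> q z" if "z \<in> D" for z
    using coer[OF that] kap by (auto simp: q_def)
  have small: "\<exists>K. \<forall>i\<ge>K. \<forall>j\<ge>K. q (Y i - Y j) < e" if "e > 0" for e
  proof -
    have "0 < e / 4" using that by simp
    then obtain K where K: "1 / real (Suc K) < e / 4"
      using reals_Archimedean unfolding inverse_eq_divide by blast
    have *: "J (Y i) - d < e / 4" if "i \<ge> K" for i
    proof -
      have "1 / real (Suc i) \<le> 1 / real (Suc K)" using that by (simp add: frac_le)
      then show ?thesis using Y(2)[of i] K by linarith
    qed
    have "q (Y i - Y j) < e" if "i \<ge> K" "j \<ge> K" for i j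
      using par[OF Y(1)[of i] Y(1)[of j]] *[OF that(1)] *[OF that(2)] by argo
    then show ?thesis by blast
  qed
  have "Cauchy Y"
  proof (rule CauchyI)
    fix e :: real assume e: "e > 0"
    obtain K where K: "\<forall>i\<ge>K. \<forall>j\<ge>K. q (Y i - Y j) < m * e\<^sup>2" using small[of "m * e\<^sup>2"] e m by auto
    have "norm (Y i - Y j) < e" if "i \<ge> K" "j \<ge> K" for i j
    proof -
      have "m * (norm (Y i - Y j))\<^sup>2 < m * e\<^sup>2"
        using K that qlow(1)[OF L(3)[OF Y(1)[of i] Y(1)[of j]]] by (meson le_less_trans)
      then have "(norm (Y i - Y j))\<^sup>2 < e\<^sup>2" using m by simp
      then show ?thesis using e by (meson less_imp_le power2_less_imp_less)
    qed
    then show "\<exists>M. \<forall>i\<ge>M. \<forall>j\<ge>M. norm (Y i - Y j) < e" by blast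
  qed
  moreover have "Cauchy (\<lambda>k. s (Y k))"
  proof (rule CauchyI)
    fix e :: real assume e: "e > 0"
    obtain K where K: "\<forall>i\<ge>K. \<forall>j\<ge>K. q (Y i - Y j) < e\<^sup>2" using small[of "e\<^sup>2"] e by auto
    have "norm (s (Y i) - s (Y j)) < e" if "i \<ge> K" "j \<ge> K" for i j
    proof -
      have "(norm (s (Y i) - s (Y j)))\<^sup>2 < e\<^sup>2"
        using K that qlow(2)[OF L(3)[OF Y(1)[of i] Y(1)[of j]]] L(7)[OF Y(1)[of i] Y(1)[of j]]
        by (metis le_less_trans)
      then show ?thesis using e by (meson less_imp_le power2_less_imp_less)
    qed
    then show "\<exists>M. \<forall>i\<ge>M. \<forall>j\<ge>M. norm (s (Y i) - s (Y j)) < e" by blast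
  qed
  ultimately obtain y \<eta> where lim: "Y \<longlonglongrightarrow> y" "(\<lambda>k. s (Y k)) \<longlonglongrightarrow> \<eta>"
    by (meson Cauchy_convergent convergent_def)
  have "(\<lambda>k. (Y k, s (Y k))) \<longlonglongrightarrow> (y, \<eta>)" using lim by (rule tendsto_Pair)
  then have "(y, \<eta>) \<in> {(x, s x) | x. x \<in> D}"
    using closed_sequentially[OF cl[unfolded closed_op_def], of "\<lambda>k. (Y k, s (Y k))"] Y(1) by blast
  then have y: "y \<in> D" "\<eta> = s y" by auto
  have "(\<lambda>k. J (Y k)) \<longlonglongrightarrow> J y"
    unfolding J_def q_def using lim y by (auto intro!: tendsto_intros)
  moreover have "(\<lambda>k. d + 1 / real (Suc k)) \<longlonglongrightarrow> d + 0"
    by (intro tendsto_intros LIMSEQ_Suc[OF lim_1_over_n])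
  ultimately have Jy: "J y \<le> d"
    using LIMSEQ_le[of "\<lambda>k. J (Y k)" "J y" _ "d + 0"] less_imp_le[OF Y(2)] by fastforce
  have var: "inner (s z) (s y) = inner z (w - \<kappa> *\<^sub>R y)" if z: "z \<in> D" for z
  proof -
    have "0 \<le> 2 * t * (inner (s y) (s z) + \<kappa> * inner y z - inner w z) + t\<^sup>2 * q z" for t
    proof -
      have "J y \<le> J (y + t *\<^sub>R z)" using Jy dle[of "y + t *\<^sub>R z"] y z L by force
      moreover have "J (y + t *\<^sub>R z) = J y + 2 * t * (inner (s y) (s z) + \<kappa> * inner y z - inner w z) + t\<^sup>2 * q z"
        using y z unfolding J_def q_def power2_norm_eq_inner
        by (simp add: L inner_add_left inner_add_right inner_commute algebra_simps power2_eq_square)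
      ultimately show ?thesis by linarith
    qed
    from nonneg_quadratic_linear_coeff_zero[OF this] show ?thesis
      by (simp add: inner_diff_right inner_commute)
  qed
  \<comment> \<open>\<open>var\<close> says that \<open>s y\<close> lies in the domain of the
    adjoint of \<open>s\<close>, with value w - \<kappa> y. Self-adjointness then yields
    \<open>s y \<in> D\<close>, a regularity that the minimisation over \<open>D\<close> did not
    impose.\<close>
  have "\<forall>v w. (\<forall>u\<in>D. inner (s u) v = inner u w) \<longrightarrow> v \<in> D \<and> w = s v"
    using sa unfolding self_adjoint_op_def by (rule conjunct2)
  then have "(\<forall>u\<in>D. inner (s u) (s y) = inner u (w - \<kappa> *\<^sub>R y)) \<longrightarrow> s y \<in> D \<and> w - \<kappa> *\<^sub>R y = s (s y)"
    by (elim allE)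
  with var have "s y \<in> D \<and> w - \<kappa> *\<^sub>R y = s (s y)" by blast
  then have "s y \<in> D" "s (s y) + \<kappa> *\<^sub>R y = w" by (auto simp: diff_eq_eq)
  then show thesis by (rule that[OF y(1)])
qed

lemma is_sqrt_opD:
  assumes "is_sqrt_op DA f DS s"
  shows "dcsa_op DS s" "lin_op DS s" "\<And>u. u \<in> DA \<longleftrightarrow> u \<in> DS \<and> s u \<in> DS" "\<And>u. u \<in> DA \<Longrightarrow> f u = s (s u)"
  using assms unfolding is_sqrt_op_def dcsa_op_def by blast+

lemma is_sqrt_op_inner:
  assumes "is_sqrt_op DA f DS s" "u \<in> DA" "v \<in> DS"
  shows "inner (f u) v = inner (s u) (s v)"
  using is_sqrt_opD[OF assms(1)] assms(2,3) self_adjoint_sym[of DS s "s u" v] by metis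

text \<open>\<open>DA\<close> is a core for the square root: \<open>(1 + \<epsilon> s\<^sup>2)\<^sup>-\<^sup>1 u\<close> tends to \<open>u\<close> and does not increase
  the norm of \<open>s u\<close>.\<close>

lemma sqrt_op_coercive:
  fixes s :: "'a::{real_inner, complete_space} \<Rightarrow> 'a"
  assumes S: "is_sqrt_op DA f DS s" and om: "\<omega> > 0"
    and coer: "\<forall>u\<in>DA. inner (f u) u \<ge> \<omega> * (norm u)\<^sup>2" and u: "u \<in> DS"
  shows "\<omega> * (norm u)\<^sup>2 \<le> (norm (s u))\<^sup>2"
proof -
  note D = is_sqrt_opD[OF S] and L = lin_op_simps[OF is_sqrt_opD(2)[OF S]]
  have "\<exists>y. norm (y - u) \<le> e * norm (s u) \<and> \<omega> * (norm y)\<^sup>2 \<le> (norm (s u))\<^sup>2" if e: "e > 0" for e :: real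
  proof -
    \<comment> \<open>With k = 1/e^2 the equation below reads (1 + e^2 s^2) y = u. The coercivity it
      requires holds trivially with m = k.\<close>
    define k where "k = 1 / e\<^sup>2"
    have k: "k > 0" using e by (simp add: k_def)
    obtain y where y: "y \<in> DS" "s y \<in> DS" "s (s y) + k *\<^sub>R y = k *\<^sub>R u"
      using sqrt_op_shift_surj[OF D(1) k less_imp_le[OF k], of "k *\<^sub>R u"] by auto
    have ssy: "s (s y) = k *\<^sub>R (u - y)" using y(3) by (simp add: algebra_simps eq_diff_eq)
    have uy: "u - y \<in> DS" using u y L by auto
    \<comment> \<open>Pairing with \<open>s y\<close> gives both bounds at once: |s y| <= |s u|, and
      k |u - y|^2 <= |s u|^2, which by the choice of k is the distance estimate.\<close>
    have "inner (s u - s y) (s y) = inner (u - y) (s (s y))"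
      using self_adjoint_sym[OF D(1) uy y(2)] L(7)[OF u y(1)] by simp
    then have eq: "inner (s u) (s y) = (norm (s y))\<^sup>2 + k * (norm (u - y))\<^sup>2"
      by (simp add: ssy inner_diff_left power2_norm_eq_inner)
    have cs: "inner (s u) (s y) \<le> norm (s u) * norm (s y)" by (rule norm_cauchy_schwarz)
    have nn: "0 \<le> k * (norm (u - y))\<^sup>2" using k by simp
    have "norm (s y) * norm (s y) \<le> norm (s u) * norm (s y)"
      using eq cs nn by (simp add: power2_eq_square)
    then have sy: "norm (s y) \<le> norm (s u)" by (cases "norm (s y) = 0") auto
    have "norm (s u) * norm (s y) \<le> (norm (s u))\<^sup>2"
      using sy by (simp add: power2_eq_square mult_left_mono)
    then have "k * (norm (u - y))\<^sup>2 \<le> (norm (s u))\<^sup>2"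
      using eq cs by (smt (verit) zero_le_power2)
    then have "(norm (u - y))\<^sup>2 \<le> (e * norm (s u))\<^sup>2"
      using e by (simp add: k_def field_simps)
    then have "norm (y - u) \<le> e * norm (s u)"
      using e by (simp add: norm_minus_commute power2_le_iff_abs_le)
    moreover have "\<omega> * (norm y)\<^sup>2 \<le> (norm (s y))\<^sup>2"
      using coer y D(3) is_sqrt_op_inner[OF S, of y y] by (metis power2_norm_eq_inner)
    moreover have "(norm (s y))\<^sup>2 \<le> (norm (s u))\<^sup>2" using sy by simp
    ultimately show ?thesis by (meson order_trans)
  qed
  then have "\<forall>k. \<exists>y. norm (y - u) \<le> (1 / real (Suc k)) * norm (s u) \<and> \<omega> * (norm y)\<^sup>2 \<le> (norm (s u))\<^sup>2"
    by (metis of_nat_0_less_iff zero_less_Suc zero_less_divide_1_iff)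
  then obtain Y where Y: "\<And>k. norm (Y k - u) \<le> (1 / real (Suc k)) * norm (s u)"
      "\<And>k. \<omega> * (norm (Y k))\<^sup>2 \<le> (norm (s u))\<^sup>2" by metis
  have "(\<lambda>k. (1 / real (Suc k)) * norm (s u)) \<longlonglongrightarrow> 0"
    by (intro tendsto_mult_left_zero LIMSEQ_Suc[OF lim_1_over_n])
  then have "(\<lambda>k. Y k - u) \<longlonglongrightarrow> 0"
    by (rule Lim_null_comparison[rotated]) (simp only: Y(1) eventually_True)
  then have "Y \<longlonglongrightarrow> u" by (rule LIM_zero_cancel)
  then have "(\<lambda>k. \<omega> * (norm (Y k))\<^sup>2) \<longlonglongrightarrow> \<omega> * (norm u)\<^sup>2" by (intro tendsto_intros)
  then show ?thesis by (rule LIMSEQ_le_const2) (simp only: Y(2), simp)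
qed

section \<open>Real interpolation\<close>

text \<open>The constant N^2 integrated against t^(-2\<theta>-1) over [r, oo) gives N^2
  r^(-2\<theta>) / (2\<theta>). The comparison of integrands is pointwise, so measurability of the
  K-functional never enters.\<close>

lemma interp_norm_lower_bound:
  assumes th: "0 < \<theta>" and r: "r > 0" and N: "N \<ge> 0"
    and K: "\<And>t. t \<ge> r \<Longrightarrow> N \<le> Kfun nX X nD D t x"
    and fin: "interp_int nX X nD D \<theta> x < \<infinity>"
  shows "N\<^sup>2 \<le> 2 * \<theta> * r powr (2 * \<theta>) * (interp_norm nX X nD D \<theta> x)\<^sup>2"
proof -
  define f where "f = (\<lambda>t. N\<^sup>2 * t powr (- 2 * \<theta> - 1))"
  define G where "G = (\<lambda>t. - (N\<^sup>2 / (2 * \<theta>)) * t powr (- 2 * \<theta>))"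
  have "(\<integral>\<^sup>+ t. ennreal (f t) * indicator {r..} t \<partial>lborel) = ennreal (0 - G r)"
  proof (rule nn_integral_FTC_atLeast)
    show "f \<in> borel_measurable borel" unfolding f_def by measurable
    show "DERIV G t :> f t" if "r \<le> t" for t
      unfolding G_def f_def using that r th
      by (auto intro!: derivative_eq_intros simp: powr_diff field_simps)
    show "0 \<le> f t" if "r \<le> t" for t by (simp add: f_def)
    have "((\<lambda>t. t powr (- 2 * \<theta>)) \<longlongrightarrow> 0) at_top"
      using th by (intro tendsto_neg_powr filterlim_ident) auto
    then show "(G \<longlongrightarrow> 0) at_top" unfolding G_def by (rule tendsto_mult_right_zero)
  qed
  moreover have "(\<integral>\<^sup>+ t. ennreal (f t) * indicator {r..} t \<partial>lborel) \<le> interp_int nX X nD D \<theta> x"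
    unfolding interp_int_def
  proof (rule nn_integral_mono)
    fix t :: real
    show "ennreal (f t) * indicator {r..} t
        \<le> ennreal ((t powr (- \<theta> - 1/2) * Kfun nX X nD D t x)\<^sup>2) * indicator {0<..} t"
    proof (cases "t \<ge> r")
      case True
      have "(t powr (- \<theta> - 1/2))\<^sup>2 = t powr (- 2 * \<theta> - 1)"
        using True r by (simp add: powr_power algebra_simps)
      moreover have "N\<^sup>2 \<le> (Kfun nX X nD D t x)\<^sup>2" using K[OF True] N by (intro power_mono)
      ultimately have "f t \<le> (t powr (- \<theta> - 1/2) * Kfun nX X nD D t x)\<^sup>2"
        using mult_left_mono[of "N\<^sup>2" "(Kfun nX X nD D t x)\<^sup>2" "t powr (- 2 * \<theta> - 1)"]
        unfolding f_def power_mult_distrib by (simp add: mult.commute)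
      then show ?thesis using True r by (simp add: ennreal_leI)
    qed simp
  qed
  \<comment> \<open>\<open>fin\<close> matters here: \<open>enn2real\<close> sends infinity to 0, so
    the bound survives the conversion to reals only for a finite integral.\<close>
  ultimately have "0 - G r \<le> enn2real (interp_int nX X nD D \<theta> x)"
    using fin enn2real_mono[of "ennreal (0 - G r)"] N th by (simp add: G_def)
  then have "N\<^sup>2 / (2 * \<theta>) * r powr (- 2 * \<theta>) \<le> (interp_norm nX X nD D \<theta> x)\<^sup>2"
    by (simp add: G_def interp_norm_def)
  then show ?thesis using th r by (simp add: powr_minus field_simps)
qed

section \<open>The energy space\<close>

locale coupled_system =
  fixes DA1 DA2 DS1 DS2 :: "'a::{real_inner, complete_space} set"
    and f1 f2 s1 s2 B :: "'a \<Rightarrow> 'a"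
    and \<omega>1 \<omega>2 \<beta> \<alpha> :: real
    and T :: "real \<Rightarrow> 'a \<times> 'a \<times> 'a \<times> 'a \<Rightarrow> 'a \<times> 'a \<times> 'a \<times> 'a"
  assumes om1: "\<omega>1 > 0" and om2: "\<omega>2 > 0"
    and coer1: "\<forall>u\<in>DA1. inner (f1 u) u \<ge> \<omega>1 * (norm u)\<^sup>2"
    and coer2: "\<forall>u\<in>DA2. inner (f2 u) u \<ge> \<omega>2 * (norm u)\<^sup>2"
    and S1: "is_sqrt_op DA1 f1 DS1 s1" and S2: "is_sqrt_op DA2 f2 DS2 s2"
    and Bbd: "bounded_linear B"
    and Bsa: "\<forall>u v. inner (B u) v = inner u (B v)"
    and beta: "\<beta> > 0" and Bcoer: "\<forall>u. inner (B u) u \<ge> \<beta> * (norm u)\<^sup>2"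
    and alpha: "0 < \<bar>\<alpha>\<bar>" "\<bar>\<alpha>\<bar> < sqrt (\<omega>1 * \<omega>2)"
    and sg: "is_C0_semigroup_gen (hnorm s1 s2 \<alpha>) (Hcar DS1 DS2) (DopA DA1 DS1 DA2 DS2)
               (opA f1 f2 B \<alpha>) T"
begin

abbreviation "X \<equiv> Hcar DS1 DS2"
abbreviation "Dm \<equiv> DopA DA1 DS1 DA2 DS2"
abbreviation "F \<equiv> opA f1 f2 B \<alpha>"
abbreviation "nm \<equiv> hnorm s1 s2 \<alpha>"
abbreviation "E U \<equiv> hinner s1 s2 \<alpha> U U"

text \<open>Recording \<open>s1 u\<close> and \<open>s2 v\<close> next to \<open>U\<close> turns the energy norm into an equivalent of the
  ordinary product norm, so that the calculus of vector-valued functions applies to orbits.\<close>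

definition J :: "'a \<times> 'a \<times> 'a \<times> 'a \<Rightarrow> ('a \<times> 'a \<times> 'a \<times> 'a) \<times> 'a \<times> 'a" where
  "J U = (U, s1 (fst U), s2 (fst (snd (snd U))))"

lemmas D1 = is_sqrt_opD[OF S1] and D2 = is_sqrt_opD[OF S2]
lemmas lin1 = lin_op_simps[OF D1(2)] and lin2 = lin_op_simps[OF D2(2)]

lemma X_iff: "(u, p, v, q) \<in> X \<longleftrightarrow> u \<in> DS1 \<and> v \<in> DS2"
  by (simp add: Hcar_def)

lemma Dm_iff: "(u, p, v, q) \<in> Dm \<longleftrightarrow> u \<in> DA1 \<and> p \<in> DS1 \<and> v \<in> DA2 \<and> q \<in> DS2"
  by (simp add: DopA_def)

lemma F_eq: "F (u, p, v, q) = (p, - f1 u - B p - \<alpha> *\<^sub>R v, q, - f2 v - \<alpha> *\<^sub>R u)"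
  by (simp add: opA_def)

lemma E_eq: "E (u, p, v, q) = (norm (s1 u))\<^sup>2 + (norm p)\<^sup>2 + (norm (s2 v))\<^sup>2 + (norm q)\<^sup>2 + 2 * \<alpha> * inner u v"
  by (simp add: hinner_def power2_norm_eq_inner inner_commute)

lemma X_subspace:
  "0 \<in> X" "\<And>U V. U \<in> X \<Longrightarrow> V \<in> X \<Longrightarrow> U + V \<in> X" "\<And>U V. U \<in> X \<Longrightarrow> V \<in> X \<Longrightarrow> U - V \<in> X"
  "\<And>r U. U \<in> X \<Longrightarrow> r *\<^sub>R U \<in> X"
  using lin1(1-4) lin2(1-4) by (auto simp: Hcar_def zero_prod_def)

lemma Dm_X: "U \<in> Dm \<Longrightarrow> U \<in> X"
  using D1(3) D2(3) by (cases U) (simp add: X_iff Dm_iff)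

lemma F_X: "U \<in> Dm \<Longrightarrow> F U \<in> X"
  by (cases U) (simp add: X_iff Dm_iff F_eq)

lemma Dm_subspace:
  "0 \<in> Dm" "\<And>U V. U \<in> Dm \<Longrightarrow> V \<in> Dm \<Longrightarrow> U - V \<in> Dm" "\<And>r U. U \<in> Dm \<Longrightarrow> r *\<^sub>R U \<in> Dm"
  using lin1(1,3,4,5,7,8) lin2(1,3,4,5,7,8) D1(3) D2(3) by (auto simp: DopA_def zero_prod_def)

lemma J_linear:
  "\<And>U V. U \<in> X \<Longrightarrow> V \<in> X \<Longrightarrow> J (U + V) = J U + J V"
  "\<And>U V. U \<in> X \<Longrightarrow> V \<in> X \<Longrightarrow> J (U - V) = J U - J V"
  "\<And>r U. U \<in> X \<Longrightarrow> J (r *\<^sub>R U) = r *\<^sub>R J U"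
  using lin1(6-8) lin2(6-8) by (auto simp: J_def Hcar_def)

section \<open>Coercivity of the energy and its equivalence with the product norm\<close>

lemma coer1': "u \<in> DS1 \<Longrightarrow> \<omega>1 * (norm u)\<^sup>2 \<le> (norm (s1 u))\<^sup>2"
  by (rule sqrt_op_coercive[OF S1 om1 coer1])

lemma coer2': "u \<in> DS2 \<Longrightarrow> \<omega>2 * (norm u)\<^sup>2 \<le> (norm (s2 u))\<^sup>2"
  by (rule sqrt_op_coercive[OF S2 om2 coer2])

text \<open>Young's inequality with weights sqrt \<omega>1 and sqrt \<omega>2 bounds 2
  sqrt(\<omega>1 \<omega>2) |u| |v| by |s1 u|^2 + |s2 v|^2, so the indefinite coupling term costs
  the fraction |\<alpha>| / sqrt(\<omega>1 \<omega>2) < 1 of the diagonal part.\<close>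

lemma E_lower:
  assumes "(u, p, v, q) \<in> X"
  shows "(1 - \<bar>\<alpha>\<bar> / sqrt (\<omega>1 * \<omega>2)) * ((norm (s1 u))\<^sup>2 + (norm p)\<^sup>2 + (norm (s2 v))\<^sup>2 + (norm q)\<^sup>2)
    \<le> E (u, p, v, q)"
proof -
  define r where "r = sqrt (\<omega>1 * \<omega>2)"
  have r: "r > 0" using om1 om2 by (simp add: r_def)
  have uv: "u \<in> DS1" "v \<in> DS2" using assms by (auto simp: X_iff)
  have "2 * ((sqrt \<omega>1 * norm u) * (sqrt \<omega>2 * norm v)) \<le> (sqrt \<omega>1 * norm u)\<^sup>2 + (sqrt \<omega>2 * norm v)\<^sup>2"
    using sum_squares_bound[of "sqrt \<omega>1 * norm u" "sqrt \<omega>2 * norm v"] by (simp add: mult.assoc)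
  then have "2 * (r * (norm u * norm v)) \<le> \<omega>1 * (norm u)\<^sup>2 + \<omega>2 * (norm v)\<^sup>2"
    using om1 om2 by (simp add: r_def real_sqrt_mult power_mult_distrib mult_ac)
  also have "\<dots> \<le> (norm (s1 u))\<^sup>2 + (norm (s2 v))\<^sup>2" using coer1'[OF uv(1)] coer2'[OF uv(2)] by simp
  finally have "\<bar>\<alpha>\<bar> / r * (2 * (r * (norm u * norm v))) \<le> \<bar>\<alpha>\<bar> / r * ((norm (s1 u))\<^sup>2 + (norm (s2 v))\<^sup>2)"
    using r by (intro mult_left_mono) auto
  moreover have "\<bar>\<alpha>\<bar> / r * (2 * (r * (norm u * norm v))) = 2 * (\<bar>\<alpha>\<bar> * (norm u * norm v))" using r by simp
  moreover have "\<bar>\<alpha> * inner u v\<bar> \<le> \<bar>\<alpha>\<bar> * (norm u * norm v)"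
    unfolding abs_mult by (intro mult_left_mono Cauchy_Schwarz_ineq2) auto
  moreover have "0 \<le> \<bar>\<alpha>\<bar> / r * ((norm p)\<^sup>2 + (norm q)\<^sup>2)" using r by simp
  ultimately have "0 \<le> \<bar>\<alpha>\<bar> / r * ((norm (s1 u))\<^sup>2 + (norm (s2 v))\<^sup>2) + \<bar>\<alpha>\<bar> / r * ((norm p)\<^sup>2 + (norm q)\<^sup>2) + 2 * (\<alpha> * inner u v)"
    by linarith
  then show ?thesis unfolding E_eq r_def[symmetric] by (simp add: algebra_simps)
qed

lemma norm_J: "(norm (J (u, p, v, q)))\<^sup>2 =
  (norm u)\<^sup>2 + (norm p)\<^sup>2 + (norm v)\<^sup>2 + (norm q)\<^sup>2 + (norm (s1 u))\<^sup>2 + (norm (s2 v))\<^sup>2"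
  by (simp add: J_def norm_Pair)

lemma J_equiv:
  obtains K where "K > 0" "\<And>U. U \<in> X \<Longrightarrow> (norm (J U))\<^sup>2 \<le> K * E U" "\<And>U. U \<in> X \<Longrightarrow> E U \<le> K * (norm (J U))\<^sup>2"
proof -
  define m where "m = 1 - \<bar>\<alpha>\<bar> / sqrt (\<omega>1 * \<omega>2)"
  have m: "m > 0" using alpha om1 om2 by (simp add: m_def)
  define K1 where "K1 = (1 + 1/\<omega>1 + 1/\<omega>2) / m"
  have K1: "K1 > 0" using m om1 om2 by (simp add: K1_def add_pos_pos)
  have up: "(norm (J U))\<^sup>2 \<le> K1 * E U" if U: "U \<in> X" for U
  proof -
    obtain u p v q where [simp]: "U = (u, p, v, q)" by (cases U)
    have uv: "u \<in> DS1" "v \<in> DS2" using U by (auto simp: X_iff)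
    define S where "S = (norm (s1 u))\<^sup>2 + (norm p)\<^sup>2 + (norm (s2 v))\<^sup>2 + (norm q)\<^sup>2"
    have "(norm u)\<^sup>2 \<le> 1/\<omega>1 * (norm (s1 u))\<^sup>2" "(norm v)\<^sup>2 \<le> 1/\<omega>2 * (norm (s2 v))\<^sup>2"
      using coer1'[OF uv(1)] coer2'[OF uv(2)] om1 om2 by (simp_all add: field_simps)
    moreover have "1/\<omega>1 * (norm (s1 u))\<^sup>2 \<le> 1/\<omega>1 * S" "1/\<omega>2 * (norm (s2 v))\<^sup>2 \<le> 1/\<omega>2 * S"
      using om1 om2 by (intro mult_left_mono; simp add: S_def)+
    ultimately have "(norm (J U))\<^sup>2 \<le> (1 + 1/\<omega>1 + 1/\<omega>2) * S"
      by (simp add: norm_J distrib_right) (simp add: S_def)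
    also have "\<dots> = K1 * (m * S)" using m by (simp add: K1_def)
    also have "\<dots> \<le> K1 * E U"
      using E_lower[of u p v q] U K1 by (intro mult_left_mono) (auto simp: S_def m_def)
    finally show ?thesis .
  qed
  have low: "E U \<le> (1 + \<bar>\<alpha>\<bar>) * (norm (J U))\<^sup>2" if "U \<in> X" for U
  proof -
    obtain u p v q where [simp]: "U = (u, p, v, q)" by (cases U)
    have "\<bar>\<alpha> * inner u v\<bar> \<le> \<bar>\<alpha>\<bar> * (norm u * norm v)"
      unfolding abs_mult by (intro mult_left_mono Cauchy_Schwarz_ineq2) auto
    then have "2 * \<alpha> * inner u v \<le> \<bar>\<alpha>\<bar> * (2 * norm u * norm v)" by simp
    also have "\<dots> \<le> \<bar>\<alpha>\<bar> * ((norm u)\<^sup>2 + (norm v)\<^sup>2)"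
      by (intro mult_left_mono sum_squares_bound) auto
    also have "\<dots> \<le> \<bar>\<alpha>\<bar> * (norm (J U))\<^sup>2" by (intro mult_left_mono) (auto simp: norm_J)
    finally have "2 * \<alpha> * inner u v \<le> \<bar>\<alpha>\<bar> * (norm (J U))\<^sup>2" .
    moreover have "(norm (s1 u))\<^sup>2 + (norm p)\<^sup>2 + (norm (s2 v))\<^sup>2 + (norm q)\<^sup>2 \<le> (norm (J U))\<^sup>2"
      by (simp add: norm_J)
    ultimately show ?thesis by (simp add: E_eq distrib_right)
  qed
  define K where "K = max K1 (1 + \<bar>\<alpha>\<bar>)"
  \<comment> \<open>Enlarging \<open>K1\<close> to \<open>K\<close> in the first bound needs
    \<open>E U\<close> to be nonnegative, which that bound itself supplies.\<close>
  have Epos: "0 \<le> E U" if "U \<in> X" for U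
    using up[OF that] K1 by (smt (verit) zero_le_mult_iff zero_le_power2)
  have "K > 0" using K1 by (simp add: K_def)
  moreover have "(norm (J U))\<^sup>2 \<le> K * E U" if "U \<in> X" for U
    using up[OF that] mult_right_mono[of K1 K, OF _ Epos[OF that]] by (simp add: K_def)
  moreover have "E U \<le> K * (norm (J U))\<^sup>2" if "U \<in> X" for U
    using low[OF that] mult_right_mono[of "1 + \<bar>\<alpha>\<bar>" K "(norm (J U))\<^sup>2"] by (simp add: K_def)
  ultimately show thesis by (rule that)
qed

lemma E_nonneg: "U \<in> X \<Longrightarrow> 0 \<le> E U"
  by (rule J_equiv) (smt (verit) zero_le_mult_iff zero_le_power2)

lemma nm_sq: "U \<in> X \<Longrightarrow> (nm U)\<^sup>2 = E U"
  using E_nonneg by (simp add: hnorm_def)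

lemma nm_nonneg: "U \<in> X \<Longrightarrow> 0 \<le> nm U"
  using E_nonneg by (simp add: hnorm_def)

lemma nm_equiv:
  obtains K where "K > 0" "\<And>U. U \<in> X \<Longrightarrow> norm (J U) \<le> K * nm U" "\<And>U. U \<in> X \<Longrightarrow> nm U \<le> K * norm (J U)"
proof -
  obtain K where K: "K > 0" "\<And>U. U \<in> X \<Longrightarrow> (norm (J U))\<^sup>2 \<le> K * E U" "\<And>U. U \<in> X \<Longrightarrow> E U \<le> K * (norm (J U))\<^sup>2"
    using J_equiv by blast
  have "norm (J U) \<le> sqrt K * nm U" if "U \<in> X" for U
    using real_sqrt_le_mono[OF K(2)[OF that]] by (simp add: hnorm_def real_sqrt_mult)
  moreover have "nm U \<le> sqrt K * norm (J U)" if "U \<in> X" for U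
    using real_sqrt_le_mono[OF K(3)[OF that]] by (simp add: hnorm_def real_sqrt_mult)
  ultimately show thesis using that[of "sqrt K"] K(1) by auto
qed

section \<open>The contraction semigroup and its generator in the product norm\<close>

lemma T_X: "t \<ge> 0 \<Longrightarrow> U \<in> X \<Longrightarrow> T t U \<in> X"
  and T_add: "t \<ge> 0 \<Longrightarrow> U \<in> X \<Longrightarrow> V \<in> X \<Longrightarrow> T t (U + V) = T t U + T t V"
  and T_scale: "t \<ge> 0 \<Longrightarrow> U \<in> X \<Longrightarrow> T t (r *\<^sub>R U) = r *\<^sub>R T t U"
  and T_contr: "t \<ge> 0 \<Longrightarrow> U \<in> X \<Longrightarrow> nm (T t U) \<le> nm U"
  and T_plus: "t \<ge> 0 \<Longrightarrow> s \<ge> 0 \<Longrightarrow> U \<in> X \<Longrightarrow> T (t + s) U = T t (T s U)"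
  and T_cont: "U \<in> X \<Longrightarrow> t \<ge> 0 \<Longrightarrow> e > 0 \<Longrightarrow> \<exists>d>0. \<forall>s\<ge>0. \<bar>s - t\<bar> < d \<longrightarrow> nm (T s U - T t U) < e"
  and T_gen: "U \<in> X \<Longrightarrow> W \<in> X \<Longrightarrow>
    ((\<lambda>h. nm ((1 / h) *\<^sub>R (T h U - U) - W)) \<longlongrightarrow> 0) (at_right 0) \<longleftrightarrow> U \<in> Dm \<and> W = F U"
  using sg unfolding is_C0_semigroup_gen_def by simp_all

lemma T_diff:
  assumes "t \<ge> 0" "U \<in> X" "V \<in> X"
  shows "T t (U - V) = T t U - T t V"
proof -
  have "T t (U + (-1) *\<^sub>R V) = T t U + (-1) *\<^sub>R T t V"
    using assms T_add[of t U "(-1) *\<^sub>R V"] T_scale[of t V "-1"] X_subspace(4)[of V "-1"] by simp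
  then show ?thesis by simp
qed

lemma T_J_bound:
  obtains M where "M > 0" "\<And>t U. t \<ge> 0 \<Longrightarrow> U \<in> X \<Longrightarrow> norm (J (T t U)) \<le> M * norm (J U)"
proof -
  obtain K where K: "K > 0" "\<And>U. U \<in> X \<Longrightarrow> norm (J U) \<le> K * nm U" "\<And>U. U \<in> X \<Longrightarrow> nm U \<le> K * norm (J U)"
    using nm_equiv by blast
  have "norm (J (T t U)) \<le> K * K * norm (J U)" if "t \<ge> 0" "U \<in> X" for t U
  proof -
    have "norm (J (T t U)) \<le> K * nm (T t U)" using K(2) T_X that by blast
    also have "\<dots> \<le> K * nm U" using K(1) T_contr[OF that] by simp
    also have "\<dots> \<le> K * (K * norm (J U))" using K(1) K(3)[OF that(2)] by simp
    finally show ?thesis by simp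
  qed
  then show thesis using that[of "K * K"] K(1) by auto
qed

lemma nm_tendsto_iff:
  assumes "eventually (\<lambda>h. W h \<in> X) \<F>"
  shows "((\<lambda>h. nm (W h)) \<longlongrightarrow> 0) \<F> \<longleftrightarrow> ((\<lambda>h. J (W h)) \<longlongrightarrow> 0) \<F>"
proof -
  obtain K where K: "K > 0" "\<And>U. U \<in> X \<Longrightarrow> norm (J U) \<le> K * nm U" "\<And>U. U \<in> X \<Longrightarrow> nm U \<le> K * norm (J U)"
    using nm_equiv by blast
  show ?thesis
  proof
    assume "((\<lambda>h. nm (W h)) \<longlongrightarrow> 0) \<F>"
    then have "((\<lambda>h. K * nm (W h)) \<longlongrightarrow> 0) \<F>" by (rule tendsto_mult_right_zero)
    moreover have "eventually (\<lambda>h. norm (J (W h)) \<le> K * nm (W h)) \<F>"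
      using assms by eventually_elim (rule K(2))
    ultimately show "((\<lambda>h. J (W h)) \<longlongrightarrow> 0) \<F>" by (rule Lim_null_comparison[rotated])
  next
    assume "((\<lambda>h. J (W h)) \<longlongrightarrow> 0) \<F>"
    then have "((\<lambda>h. K * norm (J (W h))) \<longlongrightarrow> 0) \<F>"
      by (intro tendsto_mult_right_zero tendsto_norm_zero)
    moreover have "eventually (\<lambda>h. norm (nm (W h)) \<le> K * norm (J (W h))) \<F>"
      using assms by eventually_elim (use K(3) nm_nonneg in auto)
    ultimately show "((\<lambda>h. nm (W h)) \<longlongrightarrow> 0) \<F>" by (rule Lim_null_comparison[rotated])
  qed
qed

text \<open>Restates the generator condition as an ordinary limit in a normed space. One direction
  differentiates orbits at 0, the other recognises members of \<open>Dm\<close>. Since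
  \<open>J\<close> is linear only on \<open>X\<close>, the quotients are rewritten eventually, for h
  > 0.\<close>

lemma J_gen:
  assumes "U \<in> X" "W \<in> X"
  shows "((\<lambda>h. (1 / h) *\<^sub>R (J (T h U) - J U)) \<longlongrightarrow> J W) (at_right 0) \<longleftrightarrow> U \<in> Dm \<and> W = F U"
proof -
  have ev: "eventually (\<lambda>h. (1 / h) *\<^sub>R (T h U - U) - W \<in> X) (at_right (0::real))"
    using eventually_at_right_less[of 0] by eventually_elim (use assms T_X X_subspace in auto)
  have "((\<lambda>h. (1 / h) *\<^sub>R (J (T h U) - J U)) \<longlongrightarrow> J W) (at_right 0) \<longleftrightarrow>
      ((\<lambda>h. (1 / h) *\<^sub>R (J (T h U) - J U) - J W) \<longlongrightarrow> 0) (at_right 0)"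
    by (rule LIM_zero_iff[symmetric])
  also have "\<dots> \<longleftrightarrow> ((\<lambda>h. J ((1 / h) *\<^sub>R (T h U - U) - W)) \<longlongrightarrow> 0) (at_right 0)"
  proof (rule tendsto_cong)
    show "\<forall>\<^sub>F h in at_right 0. (1 / h) *\<^sub>R (J (T h U) - J U) - J W = J ((1 / h) *\<^sub>R (T h U - U) - W)"
      using eventually_at_right_less[of 0]
    proof eventually_elim
      case (elim h)
      then have "T h U \<in> X" using T_X assms by auto
      then show ?case using assms X_subspace by (simp add: J_linear)
    qed
  qed
  also have "\<dots> \<longleftrightarrow> U \<in> Dm \<and> W = F U"
    using nm_tendsto_iff[OF ev] T_gen[OF assms] by simp
  finally show ?thesis .
qed

lemma J_cont:
  assumes U: "U \<in> X" and t: "t \<ge> 0"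
  shows "((\<lambda>s. J (T s U)) \<longlongrightarrow> J (T t U)) (at t within {0..})"
proof -
  have ev: "eventually (\<lambda>s. s \<ge> 0) (at t within {0..})"
    by (auto simp: eventually_at_filter)
  have "((\<lambda>s. nm (T s U - T t U)) \<longlongrightarrow> 0) (at t within {0..})"
  proof (rule tendstoI)
    fix e :: real assume "e > 0"
    from T_cont[OF U t this] obtain d where d: "d > 0" "\<forall>s\<ge>0. \<bar>s - t\<bar> < d \<longrightarrow> nm (T s U - T t U) < e" by blast
    show "\<forall>\<^sub>F s in at t within {0..}. dist (nm (T s U - T t U)) 0 < e"
      unfolding eventually_at using d nm_nonneg X_subspace(3) T_X U t
      by (auto simp: dist_real_def intro!: exI[of _ d])
  qed
  then have "((\<lambda>s. J (T s U - T t U)) \<longlongrightarrow> 0) (at t within {0..})"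
    by (subst nm_tendsto_iff[symmetric]) (use ev in eventually_elim, use T_X U t X_subspace in auto)
  moreover have "eventually (\<lambda>s. J (T s U - T t U) = J (T s U) - J (T t U)) (at t within {0..})"
    using ev by eventually_elim (use T_X U t J_linear in auto)
  ultimately have "((\<lambda>s. J (T s U) - J (T t U)) \<longlongrightarrow> 0) (at t within {0..})"
    by (rule Lim_transform_eventually)
  then show ?thesis by (rule LIM_zero_cancel)
qed

text \<open>\<open>T t\<close> commutes with the difference quotients at 0, and its boundedness in
  the product norm carries their convergence from U to \<open>T t U\<close>; \<open>J_gen\<close>
  then identifies the limit.\<close>

lemma
  assumes U: "U \<in> Dm" and t: "t \<ge> 0"
  shows T_Dm: "T t U \<in> Dm" and T_F: "F (T t U) = T t (F U)"
proof -
  obtain M where M: "M > 0" "\<And>t U. t \<ge> 0 \<Longrightarrow> U \<in> X \<Longrightarrow> norm (J (T t U)) \<le> M * norm (J U)"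
    using T_J_bound by blast
  have X: "U \<in> X" "F U \<in> X" "T t U \<in> X" "T t (F U) \<in> X"
    using U t by (auto intro: Dm_X F_X T_X)
  have "((\<lambda>h. (1 / h) *\<^sub>R (J (T h U) - J U)) \<longlongrightarrow> J (F U)) (at_right 0)"
    using J_gen[OF X(1,2)] U by simp
  then have "((\<lambda>h. M * norm ((1 / h) *\<^sub>R (J (T h U) - J U) - J (F U))) \<longlongrightarrow> 0) (at_right 0)"
    by (intro tendsto_mult_right_zero tendsto_norm_zero LIM_zero)
  moreover have "\<forall>\<^sub>F h in at_right 0. norm ((1 / h) *\<^sub>R (J (T h (T t U)) - J (T t U)) - J (T t (F U)))
      \<le> M * norm ((1 / h) *\<^sub>R (J (T h U) - J U) - J (F U))"
    using eventually_at_right_less[of 0]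
  proof eventually_elim
    case (elim h)
    have Xh: "T h U \<in> X" using elim X T_X by simp
    have "T h (T t U) = T t (T h U)" using T_plus[of h t U] T_plus[of t h U] elim t X by (simp add: add.commute)
    then have "(1 / h) *\<^sub>R (J (T h (T t U)) - J (T t U)) - J (T t (F U)) = J (T t ((1 / h) *\<^sub>R (T h U - U) - F U))"
      using X Xh t T_X X_subspace by (simp add: J_linear T_diff T_scale)
    moreover have "J ((1 / h) *\<^sub>R (T h U - U) - F U) = (1 / h) *\<^sub>R (J (T h U) - J U) - J (F U)"
      using X Xh X_subspace by (simp add: J_linear)
    ultimately show ?case using M(2)[of t "(1 / h) *\<^sub>R (T h U - U) - F U"] t X Xh X_subspace by simp
  qed
  ultimately have "((\<lambda>h. (1 / h) *\<^sub>R (J (T h (T t U)) - J (T t U)) - J (T t (F U))) \<longlongrightarrow> 0) (at_right 0)"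
    by (rule Lim_null_comparison[rotated])
  then have "((\<lambda>h. (1 / h) *\<^sub>R (J (T h (T t U)) - J (T t U))) \<longlongrightarrow> J (T t (F U))) (at_right 0)"
    by (rule LIM_zero_cancel)
  then show "T t U \<in> Dm" "F (T t U) = T t (F U)" using J_gen[OF X(3,4)] by auto
qed

end

section \<open>Differentiability of orbits and the energy identity\<close>

lemma has_real_derivative_inner:
  fixes f g :: "real \<Rightarrow> 'b::real_inner"
  assumes "(f has_vector_derivative f') (at t within S)" "(g has_vector_derivative g') (at t within S)"
  shows "((\<lambda>s. inner (f s) (g s)) has_real_derivative inner (f t) g' + inner f' (g t)) (at t within S)"
  unfolding has_real_derivative_iff_has_vector_derivative
  by (rule bounded_bilinear.has_vector_derivative[OF bounded_bilinear_inner assms])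

context coupled_system
begin

text \<open>The generator provides a right derivative at time 0 only. For s > t the quotient is
  \<open>T t\<close> applied to the quotient at 0 with step s - t. For s < t it is
  \<open>T s\<close> applied to the one with step t - s, and replacing \<open>T s (F U)\<close> by
  \<open>T t (F U)\<close> costs an error that vanishes by strong continuity. One bound in |s - t|
  covers both sides.\<close>

lemma J_orbit_deriv:
  assumes U: "U \<in> Dm" and t: "t \<ge> 0"
  shows "((\<lambda>s. J (T s U)) has_vector_derivative J (T t (F U))) (at t within {0..})"
proof -
  obtain M where M: "M > 0" "\<And>t U. t \<ge> 0 \<Longrightarrow> U \<in> X \<Longrightarrow> norm (J (T t U)) \<le> M * norm (J U)"
    using T_J_bound by blast
  have X: "U \<in> X" "F U \<in> X" using U by (auto intro: Dm_X F_X)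
  define Q where "Q = (\<lambda>h. (1 / h) *\<^sub>R (J (T h U) - J U) - J (F U))"
  have "(Q \<longlongrightarrow> 0) (at_right 0)"
    unfolding Q_def using J_gen[OF X] U by (intro LIM_zero) simp
  moreover have "filterlim (\<lambda>s. \<bar>s - t\<bar>) (at_right 0) (at t within {0..})"
    unfolding filterlim_at
    by (auto simp: eventually_at_filter intro!: tendsto_eq_intros)
  ultimately have "((\<lambda>s. Q \<bar>s - t\<bar>) \<longlongrightarrow> 0) (at t within {0..})" by (rule filterlim_compose)
  then have "((\<lambda>s. M * norm (Q \<bar>s - t\<bar>) + norm (J (T s (F U)) - J (T t (F U)))) \<longlongrightarrow> M * 0 + 0) (at t within {0..})"
    by (intro tendsto_intros tendsto_norm_zero LIM_zero J_cont X t)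
  then have lim: "((\<lambda>s. M * norm (Q \<bar>s - t\<bar>) + norm (J (T s (F U)) - J (T t (F U)))) \<longlongrightarrow> 0) (at t within {0..})"
    by simp
  have QJ: "Q h = J ((1 / h) *\<^sub>R (T h U - U) - F U)" if "h > 0" for h
    using that X T_X[of h U] X_subspace unfolding Q_def by (simp add: J_linear)
  have shift: "norm ((1 / h) *\<^sub>R (J (T (r + h) U) - J (T r U)) - J (T r (F U))) \<le> M * norm (Q h)"
    if "h > 0" "r \<ge> 0" for h r
  proof -
    have Xh: "T h U \<in> X" using that X T_X by simp
    have "(1 / h) *\<^sub>R (J (T (r + h) U) - J (T r U)) - J (T r (F U)) = J (T r ((1 / h) *\<^sub>R (T h U - U) - F U))"
      using X Xh that T_X X_subspace by (simp add: J_linear T_diff T_scale T_plus)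
    then show ?thesis
      using M(2)[of r "(1 / h) *\<^sub>R (T h U - U) - F U"] that X Xh X_subspace QJ[OF that(1)] by simp
  qed
  have bound: "norm ((1 / norm (s - t)) *\<^sub>R (J (T s U) - (J (T t U) + (s - t) *\<^sub>R J (T t (F U)))))
      \<le> M * norm (Q \<bar>s - t\<bar>) + norm (J (T s (F U)) - J (T t (F U)))"
    if s: "s \<noteq> t" "s \<ge> 0" for s
  proof (cases "s > t")
    case True
    have "(1 / norm (s - t)) *\<^sub>R (J (T s U) - (J (T t U) + (s - t) *\<^sub>R J (T t (F U)))) =
      (1 / (s - t)) *\<^sub>R (J (T (t + (s - t)) U) - J (T t U)) - J (T t (F U))"
    proof -
      have "(1 / norm (s - t)) *\<^sub>R ((s - t) *\<^sub>R J (T t (F U))) = J (T t (F U))"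
        using True by simp
      then show ?thesis using True unfolding scaleR_diff_right scaleR_add_right by simp
    qed
    then show ?thesis using shift[of "s - t" t] True t by (simp add: add_increasing2)
  next
    case False
    then have st: "s < t" using s by simp
    have eq: "(1 / norm (s - t)) *\<^sub>R (J (T s U) - (J (T t U) + (s - t) *\<^sub>R J (T t (F U)))) =
      - ((1 / (t - s)) *\<^sub>R (J (T (s + (t - s)) U) - J (T s U)) - J (T s (F U))) - (J (T s (F U)) - J (T t (F U)))"
    proof -
      have "(1 / norm (s - t)) *\<^sub>R ((s - t) *\<^sub>R J (T t (F U))) = - J (T t (F U))"
      proof -
        have "(s - t) / (t - s) = -1" using st by (simp add: divide_eq_eq)
        then show ?thesis using st by simp
      qed
      then show ?thesis using st unfolding scaleR_diff_right scaleR_add_right by simp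
    qed
    have "norm ((1 / norm (s - t)) *\<^sub>R (J (T s U) - (J (T t U) + (s - t) *\<^sub>R J (T t (F U)))))
        \<le> norm ((1 / (t - s)) *\<^sub>R (J (T (s + (t - s)) U) - J (T s U)) - J (T s (F U)))
        + norm (J (T s (F U)) - J (T t (F U)))"
      unfolding eq by (rule order_trans[OF norm_triangle_ineq4]) (simp only: norm_minus_cancel order_refl)
    also have "\<dots> \<le> M * norm (Q (t - s)) + norm (J (T s (F U)) - J (T t (F U)))"
      using st s by (intro add_right_mono shift) simp_all
    finally show ?thesis using st by (simp add: abs_minus_commute)
  qed
  have ev: "\<forall>\<^sub>F s in at t within {0..}. norm ((1 / norm (s - t)) *\<^sub>R (J (T s U) - (J (T t U) + (s - t) *\<^sub>R J (T t (F U)))))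
      \<le> M * norm (Q \<bar>s - t\<bar>) + norm (J (T s (F U)) - J (T t (F U)))"
    using bound by (auto simp: eventually_at_filter)
  show ?thesis unfolding has_vector_derivative_def has_derivative_within
    using Lim_null_comparison[OF ev lim] by (auto intro: bounded_linear_scaleR_left)
qed

lemma orbit_deriv:
  assumes U: "U \<in> Dm" and t: "t \<ge> 0"
  shows "((\<lambda>s. fst (T s U)) has_vector_derivative fst (T t (F U))) (at t within {0..})"
    "((\<lambda>s. fst (snd (T s U))) has_vector_derivative fst (snd (T t (F U)))) (at t within {0..})"
    "((\<lambda>s. fst (snd (snd (T s U)))) has_vector_derivative fst (snd (snd (T t (F U))))) (at t within {0..})"
    "((\<lambda>s. snd (snd (snd (T s U)))) has_vector_derivative snd (snd (snd (T t (F U))))) (at t within {0..})"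
    "((\<lambda>s. s1 (fst (T s U))) has_vector_derivative s1 (fst (T t (F U)))) (at t within {0..})"
    "((\<lambda>s. s2 (fst (snd (snd (T s U))))) has_vector_derivative s2 (fst (snd (snd (T t (F U)))))) (at t within {0..})"
proof -
  note der = J_orbit_deriv[OF U t]
  have *: "((\<lambda>s. L (J (T s U))) has_vector_derivative L (J (T t (F U)))) (at t within {0..})"
    if "bounded_linear L" for L :: "_ \<Rightarrow> 'a"
    by (rule bounded_linear.has_vector_derivative[OF that der])
  show "((\<lambda>s. fst (T s U)) has_vector_derivative fst (T t (F U))) (at t within {0..})"
    using *[of "\<lambda>x. fst (fst x)"] by (simp add: J_def bounded_linear_fst_comp)
  show "((\<lambda>s. fst (snd (T s U))) has_vector_derivative fst (snd (T t (F U)))) (at t within {0..})"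
    using *[of "\<lambda>x. fst (snd (fst x))"] by (simp add: J_def bounded_linear_fst_comp bounded_linear_snd_comp)
  show "((\<lambda>s. fst (snd (snd (T s U)))) has_vector_derivative fst (snd (snd (T t (F U))))) (at t within {0..})"
    using *[of "\<lambda>x. fst (snd (snd (fst x)))"] by (simp add: J_def bounded_linear_fst_comp bounded_linear_snd_comp)
  show "((\<lambda>s. snd (snd (snd (T s U)))) has_vector_derivative snd (snd (snd (T t (F U))))) (at t within {0..})"
    using *[of "\<lambda>x. snd (snd (snd (fst x)))"] by (simp add: J_def bounded_linear_fst_comp bounded_linear_snd_comp)
  show "((\<lambda>s. s1 (fst (T s U))) has_vector_derivative s1 (fst (T t (F U)))) (at t within {0..})"
    using *[of "\<lambda>x. fst (snd x)"] by (simp add: J_def bounded_linear_fst_comp bounded_linear_snd_comp)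
  show "((\<lambda>s. s2 (fst (snd (snd (T s U))))) has_vector_derivative s2 (fst (snd (snd (T t (F U)))))) (at t within {0..})"
    using *[of "\<lambda>x. snd (snd x)"] by (simp add: J_def bounded_linear_fst_comp bounded_linear_snd_comp)
qed

lemma E_alt: "E U = inner (s1 (fst U)) (s1 (fst U)) + inner (fst (snd U)) (fst (snd U))
    + inner (s2 (fst (snd (snd U)))) (s2 (fst (snd (snd U)))) + inner (snd (snd (snd U))) (snd (snd (snd U)))
    + 2 * (\<alpha> * inner (fst U) (fst (snd (snd U))))"
  by (cases U) (simp add: hinner_def inner_commute)

text \<open>In the energy inner product the elastic terms and the coupling terms cancel in pairs,
  and only the damping remains.\<close>

lemma dissipation:
  assumes "U \<in> Dm"
  shows "hinner s1 s2 \<alpha> U (F U) = - inner (B (fst (snd U))) (fst (snd U))"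
proof -
  obtain u p v q where [simp]: "U = (u, p, v, q)" by (cases U)
  have "u \<in> DA1" "p \<in> DS1" "v \<in> DA2" "q \<in> DS2" using assms by (auto simp: Dm_iff)
  then have "inner (f1 u) p = inner (s1 u) (s1 p)" "inner (f2 v) q = inner (s2 v) (s2 q)"
    by (auto intro: is_sqrt_op_inner[OF S1] is_sqrt_op_inner[OF S2])
  then show ?thesis
    by (simp add: opA_def hinner_def inner_diff_right inner_commute)
qed

lemma energy_deriv:
  assumes U: "U \<in> Dm" and t: "t \<ge> 0"
  shows "((\<lambda>s. E (T s U)) has_real_derivative - 2 * inner (B (fst (snd (T t U)))) (fst (snd (T t U)))) (at t within {0..})"
proof -
  note d = orbit_deriv[OF U t]
  have "((\<lambda>s. E (T s U)) has_real_derivative 2 * hinner s1 s2 \<alpha> (T t U) (T t (F U))) (at t within {0..})"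
    unfolding E_alt
    by (rule DERIV_cong, (rule DERIV_add DERIV_cmult has_real_derivative_inner d)+)
      (simp add: hinner_def inner_commute algebra_simps split: prod.split)
  then show ?thesis
    using dissipation[OF T_Dm[OF U t]] T_F[OF U t] by simp
qed

lemma B_bound: obtains b where "b > 0" "\<And>x. norm (B x) \<le> b * norm x"
  using bounded_linear.pos_bounded[OF Bbd] by (metis mult.commute)

lemma fst_snd_le_J: "norm (fst (snd U)) \<le> norm (J U)"
proof (rule power2_le_imp_le)
  show "(norm (fst (snd U)))\<^sup>2 \<le> (norm (J U))\<^sup>2" by (cases U) (simp add: norm_J)
qed simp

text \<open>Energies of merely mild solutions: for data in the range of the generator, the difference
  quotients \<open>(T h V - V) / h\<close> supply approximations in its domain.\<close>

lemma energy_deriv_range: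
  assumes V: "V \<in> Dm" and t: "t \<ge> 0"
  defines "P \<equiv> \<lambda>s U. fst (snd (T s U))"
  shows "((\<lambda>s. E (T s (F V))) has_real_derivative - 2 * inner (B (P t (F V))) (P t (F V))) (at t within {0..})"
proof -
  obtain M where M: "M > 0" "\<And>t U. t \<ge> 0 \<Longrightarrow> U \<in> X \<Longrightarrow> norm (J (T t U)) \<le> M * norm (J U)"
    using T_J_bound by blast
  obtain b where b: "b > 0" "\<And>x. norm (B x) \<le> b * norm x" using B_bound by blast
  define h where "h = (\<lambda>n. 1 / real (Suc n))"
  define W where "W = (\<lambda>n. (1 / h n) *\<^sub>R (T (h n) V - V))"
  have h: "h n > 0" for n by (simp add: h_def)
  have VX: "V \<in> X" "F V \<in> X" using V by (auto intro: Dm_X F_X)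
  have WD: "W n \<in> Dm" for n
    unfolding W_def using V T_Dm[OF V less_imp_le[OF h]] Dm_subspace by auto
  have WX: "W n \<in> X" for n by (rule Dm_X[OF WD])
  have JW: "(\<lambda>n. J (W n)) \<longlonglongrightarrow> J (F V)"
  proof -
    have "((\<lambda>h. (1 / h) *\<^sub>R (J (T h V) - J V)) \<longlongrightarrow> J (F V)) (at_right 0)"
      using J_gen[OF VX] V by simp
    moreover have "filterlim h (at_right 0) sequentially"
      unfolding filterlim_at using h LIMSEQ_Suc[OF lim_1_over_n[where 'a = real]] by (simp add: h_def)
    ultimately have "(\<lambda>n. (1 / h n) *\<^sub>R (J (T (h n) V) - J V)) \<longlonglongrightarrow> J (F V)"
      by (rule filterlim_compose)
    moreover have "(1 / h n) *\<^sub>R (J (T (h n) V) - J V) = J (W n)" for n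
      unfolding W_def using VX T_X[OF less_imp_le[OF h]] X_subspace by (simp add: J_linear)
    ultimately show ?thesis by simp
  qed
  have JTdiff: "norm (J (T s (W n)) - J (T s (F V))) \<le> M * norm (J (W n) - J (F V))" if "s \<ge> 0" for s n
    using M(2)[OF that, of "W n - F V"] that WX VX X_subspace T_X by (simp add: T_diff J_linear)
  have Pdiff: "norm (P s (W n) - P s (F V)) \<le> M * norm (J (W n) - J (F V))" if "s \<ge> 0" for s n
    using fst_snd_le_J[of "T s (W n) - T s (F V)"] JTdiff[OF that, of n] that WX VX T_X
    by (simp add: P_def J_linear)
  have Pn: "norm (P s U) \<le> M * norm (J U)" if "s \<ge> 0" "U \<in> X" for s U
    using fst_snd_le_J[of "T s U"] M(2)[OF that] by (simp add: P_def)
  define D where "D = (\<lambda>s U. - 2 * inner (B (P s U)) (P s U))"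
  \<comment> \<open>A bound free of s, available because the bound \<open>M\<close> on the semigroup
    is uniform in time; it makes the derivatives of the approximating energies converge uniformly on
    the half-line.\<close>
  define e where "e = (\<lambda>n. 2 * (b * (M * norm (J (W n) - J (F V))) * (M * norm (J (W n)) + M * norm (J (F V)))))"
  have Ddiff: "\<bar>D s (W n) - D s (F V)\<bar> \<le> e n" if s: "s \<ge> 0" for s n
  proof -
    define x y where "x = P s (W n)" and "y = P s (F V)"
    have "inner (B x) y = inner (B y) x" using Bsa by (metis inner_commute)
    then have "inner (B x) x - inner (B y) y = inner (B (x - y)) (x + y)"
      by (simp add: linear_diff[OF bounded_linear.linear[OF Bbd]] inner_diff_left inner_add_right)
    also have "\<bar>\<dots>\<bar> \<le> norm (B (x - y)) * norm (x + y)" by (rule Cauchy_Schwarz_ineq2)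
    also have "\<dots> \<le> (b * (M * norm (J (W n) - J (F V)))) * (M * norm (J (W n)) + M * norm (J (F V)))"
    proof (rule mult_mono)
      have "norm (B (x - y)) \<le> b * norm (x - y)" by (rule b)
      also have "\<dots> \<le> b * (M * norm (J (W n) - J (F V)))"
        using Pdiff[OF s, of n] b(1) unfolding x_def y_def by (intro mult_left_mono) auto
      finally show "norm (B (x - y)) \<le> b * (M * norm (J (W n) - J (F V)))" .
      show "norm (x + y) \<le> M * norm (J (W n)) + M * norm (J (F V))"
        using Pn[OF s WX, of n] Pn[OF s VX(2)] norm_triangle_ineq[of x y] unfolding x_def y_def by linarith
    qed (use b M in auto)
    finally show ?thesis unfolding D_def e_def x_def y_def by linarith
  qed
  have "e \<longlonglongrightarrow> 2 * (b * (M * norm (J (F V) - J (F V))) * (M * norm (J (F V)) + M * norm (J (F V))))"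
    unfolding e_def by (intro tendsto_intros JW)
  then have e0: "e \<longlonglongrightarrow> 0" by simp
  have Elim: "(\<lambda>n. E (T s (W n))) \<longlonglongrightarrow> E (T s (F V))" if s: "s \<ge> 0" for s
  proof -
    have "(\<lambda>n. M * norm (J (W n) - J (F V))) \<longlonglongrightarrow> M * norm (J (F V) - J (F V))"
      by (intro tendsto_intros JW)
    then have "(\<lambda>n. M * norm (J (W n) - J (F V))) \<longlonglongrightarrow> 0" by simp
    then have "(\<lambda>n. J (T s (W n)) - J (T s (F V))) \<longlonglongrightarrow> 0"
      by (rule Lim_null_comparison[rotated]) (simp add: JTdiff[OF s])
    then have "(\<lambda>n. J (T s (W n))) \<longlonglongrightarrow> J (T s (F V))" by (rule LIM_zero_cancel)
    then have 1: "(\<lambda>n. fst (J (T s (W n)))) \<longlonglongrightarrow> fst (J (T s (F V)))"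
      "(\<lambda>n. fst (snd (J (T s (W n))))) \<longlonglongrightarrow> fst (snd (J (T s (F V))))"
      "(\<lambda>n. snd (snd (J (T s (W n))))) \<longlonglongrightarrow> snd (snd (J (T s (F V))))"
      by (auto intro: tendsto_fst tendsto_snd)
    then show ?thesis unfolding E_alt J_def fst_conv snd_conv
      by (intro tendsto_intros)
  qed
  \<comment> \<open>The theorem on sequences of derivatives returns an anonymous limit
    \<open>g\<close>; pointwise convergence of the energies identifies it afterwards.\<close>
  have "\<exists>g. \<forall>x\<in>{0..}. (\<lambda>n. E (T x (W n))) \<longlonglongrightarrow> g x \<and> (g has_derivative (\<lambda>k. D x (F V) * k)) (at x within {0..})"
  proof (rule has_derivative_sequence[where f' = "\<lambda>n x k. D x (W n) * k" and ?x0.0 = 0])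
    show "convex {0::real..}" by simp
    show "((\<lambda>x. E (T x (W n))) has_derivative (\<lambda>k. D x (W n) * k)) (at x within {0..})" if "x \<in> {0..}" for n x
      using energy_deriv[OF WD[of n] that[unfolded atLeast_iff]] unfolding has_field_derivative_def D_def P_def .
    show "\<forall>\<^sub>F n in sequentially. \<forall>x\<in>{0..}. \<forall>k. norm (D x (W n) * k - D x (F V) * k) \<le> \<epsilon> * norm k"
      if "\<epsilon> > 0" for \<epsilon> :: real
    proof -
      have "\<forall>\<^sub>F n in sequentially. e n < \<epsilon>" using order_tendstoD(2)[OF e0 that] .
      then show ?thesis
      proof eventually_elim
        case (elim n)
        have "norm (D x (W n) * k - D x (F V) * k) \<le> \<epsilon> * norm k" if "x \<ge> 0" for x k
        proof -
          have "norm (D x (W n) * k - D x (F V) * k) = \<bar>D x (W n) - D x (F V)\<bar> * \<bar>k\<bar>"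
            by (simp add: left_diff_distrib[symmetric] abs_mult)
          also have "\<dots> \<le> \<epsilon> * \<bar>k\<bar>" using Ddiff[OF that, of n] elim by (intro mult_right_mono) auto
          finally show ?thesis by simp
        qed
        then show ?case by simp
      qed
    qed
    show "(\<lambda>n. E (T 0 (W n))) \<longlonglongrightarrow> E (T 0 (F V))" by (rule Elim) simp
  qed simp
  then obtain g where g: "\<And>x. x \<ge> 0 \<Longrightarrow> (\<lambda>n. E (T x (W n))) \<longlonglongrightarrow> g x"
    "\<And>x. x \<ge> 0 \<Longrightarrow> (g has_derivative (\<lambda>k. D x (F V) * k)) (at x within {0..})" by auto
  have "g x = E (T x (F V))" if "x \<ge> 0" for x using LIMSEQ_unique[OF g(1) Elim] that by auto
  then have "((\<lambda>s. E (T s (F V))) has_derivative (\<lambda>k. D t (F V) * k)) (at t within {0..})"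
    using has_derivative_transform[OF _ _ g(2)[OF t]] t by auto
  then show ?thesis unfolding has_field_derivative_def D_def .
qed

end

section \<open>Polynomial decay\<close>

lemma sum4_sq_le:
  fixes a b c d :: real
  shows "(a + b + c + d)\<^sup>2 \<le> 4 * (a\<^sup>2 + b\<^sup>2 + c\<^sup>2 + d\<^sup>2)"
proof -
  have "4 * (a\<^sup>2 + b\<^sup>2 + c\<^sup>2 + d\<^sup>2) - (a + b + c + d)\<^sup>2
      = (a - b)\<^sup>2 + (a - c)\<^sup>2 + (a - d)\<^sup>2 + (b - c)\<^sup>2 + (b - d)\<^sup>2 + (c - d)\<^sup>2"
    by (simp add: power2_eq_square algebra_simps)
  then show ?thesis by (smt (verit) zero_le_power2)
qed

lemma abs_inner_le_sum_sq: "\<bar>inner x y\<bar> \<le> ((norm x)\<^sup>2 + (norm y)\<^sup>2) / 2"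
  using Cauchy_Schwarz_ineq2[of x y] sum_squares_bound[of "norm x" "norm y"] by simp

context coupled_system
begin

section \<open>Domains of powers of the generator\<close>

lemma dom_pow_X: "U \<in> dom_pow X Dm F k \<Longrightarrow> U \<in> X"
  by (cases k) (auto intro: Dm_X)

lemma dom_pow_add: "U \<in> dom_pow X Dm F (i + k) \<Longrightarrow> (F ^^ i) U \<in> dom_pow X Dm F k"
  by (induction i arbitrary: U) (simp_all del: funpow.simps add: funpow_Suc_right)

lemma dom_pow_mono: "U \<in> dom_pow X Dm F (i + k) \<Longrightarrow> U \<in> dom_pow X Dm F i"
  by (induction i arbitrary: U) (auto intro: dom_pow_X)

lemma dom_pow_Dm: "U \<in> dom_pow X Dm F k \<Longrightarrow> i < k \<Longrightarrow> (F ^^ i) U \<in> Dm"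
  using dom_pow_add[of U i "Suc (k - Suc i)"] by simp

lemma dom_pow_iterate_X: "U \<in> dom_pow X Dm F k \<Longrightarrow> i \<le> k \<Longrightarrow> (F ^^ i) U \<in> X"
  using dom_pow_add[of U i "k - i"] by (auto intro: dom_pow_X)

lemma dom_pow_T:
  "U \<in> dom_pow X Dm F k \<Longrightarrow> t \<ge> 0 \<Longrightarrow> T t U \<in> dom_pow X Dm F k"
  by (induction k arbitrary: U) (auto simp: T_X T_Dm T_F)

lemma funpow_T:
  "U \<in> dom_pow X Dm F k \<Longrightarrow> i \<le> k \<Longrightarrow> t \<ge> 0 \<Longrightarrow> (F ^^ i) (T t U) = T t ((F ^^ i) U)"
  by (induction i) (auto simp: T_F dom_pow_Dm)

lemma E_T_le: "t \<ge> 0 \<Longrightarrow> U \<in> X \<Longrightarrow> E (T t U) \<le> E U"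
  using T_contr[of t U] T_X[of t U] nm_nonneg[of "T t U"] power_mono[of "nm (T t U)" "nm U" 2]
  by (simp add: nm_sq)

text \<open>Provides A2^(-1) w. The shift 0 is admissible because the coercivity of
  \<open>s2\<close> already supplies the positive constant.\<close>

lemma f2_surj: obtains y where "y \<in> DA2" "f2 y = w"
proof -
  obtain y where "y \<in> DS2" "s2 y \<in> DS2" "s2 (s2 y) + 0 *\<^sub>R y = w"
    using sqrt_op_shift_surj[OF D2(1) om2, of 0 w] coer2' by auto
  then show thesis using that[of y] D2(3,4) by simp
qed

end

text \<open>Isolates the domain condition, which enters the argument through the estimate of v_1
  alone.\<close>

locale weakly_coupled_system = coupled_system +
  fixes c :: real
  assumes dom: "DA2 \<subseteq> DS1" and cpos: "c > 0"
    and cbound: "\<forall>u\<in>DA2. norm (s1 u) \<le> c * norm (f2 u)"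
begin

text \<open>The undamped component is tested against \<open>A\<^sub>2\<^sup>-\<^sup>1 v\<^sub>1\<close>; the domain condition makes
  \<open>A\<^sub>1\<^sup>1\<^sup>/\<^sup>2 A\<^sub>2\<^sup>-\<^sup>1\<close> bounded. Subscripts stand for time derivatives.\<close>

lemma v_estimate:
  "\<exists>K>0. \<forall>u1 v1 u3 v3 u4 u5. v1 \<in> DA2 \<longrightarrow> u3 \<in> DA1 \<longrightarrow> v3 = - f2 v1 - \<alpha> *\<^sub>R u1 \<longrightarrow>
      u5 = - f1 u3 - B u4 - \<alpha> *\<^sub>R v3 \<longrightarrow>
      (norm v1)\<^sup>2 \<le> K * ((norm u5)\<^sup>2 + (norm u4)\<^sup>2 + (norm u1)\<^sup>2 + (norm (s1 u3))\<^sup>2)"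
proof -
  obtain b where b: "b > 0" "\<And>x. norm (B x) \<le> b * norm x" using B_bound by blast
  \<comment> \<open>The numbers 1, b and \<alpha>^2 are the factors of u_5, u_4 and u_1, divided by
    \<omega>2 since |y| <= |v_1| / \<omega>2 for y = A2^(-1) v_1; \<open>c\<close> is the bound for
    A1^(1/2) y, paired with A1^(1/2) u_3.\<close>
  define L where "L = (1 + b + \<alpha>\<^sup>2) / \<omega>2 + c"
  have L: "L > 0" using b om2 cpos by (simp add: L_def add_pos_nonneg add_pos_pos)
  have "(norm v1)\<^sup>2 \<le> (4 * L\<^sup>2 / \<alpha>\<^sup>2) * ((norm u5)\<^sup>2 + (norm u4)\<^sup>2 + (norm u1)\<^sup>2 + (norm (s1 u3))\<^sup>2)"
    if v1: "v1 \<in> DA2" and u3: "u3 \<in> DA1" and v3: "v3 = - f2 v1 - \<alpha> *\<^sub>R u1"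
      and u5: "u5 = - f1 u3 - B u4 - \<alpha> *\<^sub>R v3" for u1 v1 u3 v3 u4 u5
  proof -
    obtain y where y: "y \<in> DA2" "f2 y = v1" using f2_surj by blast
    have y1: "y \<in> DS1" using y dom by auto
    have y2: "y \<in> DS2" "v1 \<in> DS2" using y v1 D2(3) by auto
    have "inner (f2 y) v1 = inner (f2 v1) y"
      using is_sqrt_op_inner[OF S2 y(1) y2(2)] is_sqrt_op_inner[OF S2 v1 y2(1)] by (simp add: inner_commute)
    \<comment> \<open>Symmetry of A2 makes the pairing of A2 v_1 with A2^(-1) v_1 equal to |v_1|^2.
      Eliminating v_3 from the two equations writes \<alpha> A2 v_1 in terms of u alone, and half of
      A1 u_3 is moved onto y.\<close>
    then have "\<alpha> * (norm v1)\<^sup>2 = inner (\<alpha> *\<^sub>R f2 v1) y"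
      using y by (simp add: power2_norm_eq_inner)
    also have "\<alpha> *\<^sub>R f2 v1 = (u5 + B u4 - \<alpha>\<^sup>2 *\<^sub>R u1) + f1 u3"
      by (simp add: u5 v3 algebra_simps power2_eq_square)
    also have "inner \<dots> y = inner (u5 + B u4 - \<alpha>\<^sup>2 *\<^sub>R u1) y + inner (s1 u3) (s1 y)"
      using is_sqrt_op_inner[OF S1 u3 y1] by (simp add: inner_add_left)
    finally have eq: "\<alpha> * (norm v1)\<^sup>2 = inner (u5 + B u4 - \<alpha>\<^sup>2 *\<^sub>R u1) y + inner (s1 u3) (s1 y)" .
    have "\<omega>2 * (norm y)\<^sup>2 \<le> inner v1 y" using coer2 y by auto
    also have "\<dots> \<le> norm v1 * norm y" by (rule norm_cauchy_schwarz)
    finally have "\<omega>2 * norm y \<le> norm v1" by (cases "y = 0") (simp_all add: power2_eq_square)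
    then have ny: "norm y \<le> norm v1 / \<omega>2" using om2 by (simp add: field_simps)
    have nsy: "norm (s1 y) \<le> c * norm v1" using cbound y by auto
    define S where "S = norm u5 + norm u4 + norm u1 + norm (s1 u3)"
    have S: "norm u5 \<le> S" "norm u4 \<le> S" "norm u1 \<le> S" "norm (s1 u3) \<le> S" "0 \<le> S" by (auto simp: S_def)
    have "norm (u5 + B u4 - \<alpha>\<^sup>2 *\<^sub>R u1) \<le> norm u5 + norm (B u4) + \<alpha>\<^sup>2 * norm u1"
      using norm_triangle_ineq4[of "u5 + B u4" "\<alpha>\<^sup>2 *\<^sub>R u1"] norm_triangle_ineq[of u5 "B u4"] by simp
    also have "\<dots> \<le> S + b * S + \<alpha>\<^sup>2 * S"
    proof (intro add_mono S mult_left_mono)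
      show "norm (B u4) \<le> b * S" using b(2)[of u4] mult_left_mono[OF S(2), of b] b(1) by linarith
    qed simp
    finally have n1: "norm (u5 + B u4 - \<alpha>\<^sup>2 *\<^sub>R u1) \<le> (1 + b + \<alpha>\<^sup>2) * S" by (simp add: algebra_simps)
    have "\<bar>inner (u5 + B u4 - \<alpha>\<^sup>2 *\<^sub>R u1) y\<bar> \<le> norm (u5 + B u4 - \<alpha>\<^sup>2 *\<^sub>R u1) * norm y"
      by (rule Cauchy_Schwarz_ineq2)
    also have "\<dots> \<le> ((1 + b + \<alpha>\<^sup>2) * S) * (norm v1 / \<omega>2)"
      using b S om2 by (intro mult_mono n1 ny) auto
    finally have i1: "\<bar>inner (u5 + B u4 - \<alpha>\<^sup>2 *\<^sub>R u1) y\<bar> \<le> ((1 + b + \<alpha>\<^sup>2) * S) * (norm v1 / \<omega>2)" .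
    have "\<bar>inner (s1 u3) (s1 y)\<bar> \<le> norm (s1 u3) * norm (s1 y)" by (rule Cauchy_Schwarz_ineq2)
    also have "\<dots> \<le> S * (c * norm v1)" using S by (intro mult_mono nsy) auto
    finally have i2: "\<bar>inner (s1 u3) (s1 y)\<bar> \<le> S * (c * norm v1)" .
    have "\<bar>\<alpha> * (norm v1)\<^sup>2\<bar> \<le> ((1 + b + \<alpha>\<^sup>2) * S) * (norm v1 / \<omega>2) + S * (c * norm v1)"
      unfolding eq using i1 i2 by linarith
    also have "\<dots> = L * S * norm v1" by (simp add: L_def add_divide_distrib algebra_simps)
    finally have "\<bar>\<alpha>\<bar> * norm v1 \<le> L * S"
      using L S(5) by (cases "v1 = 0") (simp_all add: abs_mult power2_eq_square)
    then have "(\<bar>\<alpha>\<bar> * norm v1)\<^sup>2 \<le> (L * S)\<^sup>2" by (intro power_mono) auto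
    then have "\<alpha>\<^sup>2 * (norm v1)\<^sup>2 \<le> L\<^sup>2 * S\<^sup>2" by (simp add: power_mult_distrib)
    also have "\<dots> \<le> L\<^sup>2 * (4 * ((norm u5)\<^sup>2 + (norm u4)\<^sup>2 + (norm u1)\<^sup>2 + (norm (s1 u3))\<^sup>2))"
      unfolding S_def by (intro mult_left_mono sum4_sq_le) auto
    finally show ?thesis using alpha by (simp add: field_simps)
  qed
  note bound = this
  have "4 * L\<^sup>2 / \<alpha>\<^sup>2 > 0" using L alpha by simp
  then show ?thesis using bound by (intro exI[of _ "4 * L\<^sup>2 / \<alpha>\<^sup>2"] conjI allI impI) simp_all
qed

lemma polynomial_decay_step:
  obtains C where "C > 0"
    "\<And>U t. U \<in> dom_pow X Dm F 4 \<Longrightarrow> t > 0 \<Longrightarrow> t * E (T t U) \<le> C * (\<Sum>k\<le>4. E ((F ^^ k) U))"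
proof -
  obtain b where b: "b > 0" "\<And>x. norm (B x) \<le> b * norm x" using B_bound by blast
  obtain K where K: "K > 0" "\<forall>u1 v1 u3 v3 u4 u5. v1 \<in> DA2 \<longrightarrow> u3 \<in> DA1 \<longrightarrow> v3 = - f2 v1 - \<alpha> *\<^sub>R u1 \<longrightarrow>
      u5 = - f1 u3 - B u4 - \<alpha> *\<^sub>R v3 \<longrightarrow>
      (norm v1)\<^sup>2 \<le> K * ((norm u5)\<^sup>2 + (norm u4)\<^sup>2 + (norm u1)\<^sup>2 + (norm (s1 u3))\<^sup>2)"
    using v_estimate by (elim exE conjE)
  obtain KJ where KJ: "KJ > 0" "\<And>U. U \<in> X \<Longrightarrow> (norm (J U))\<^sup>2 \<le> KJ * E U"
      "\<And>U. U \<in> X \<Longrightarrow> E U \<le> KJ * (norm (J U))\<^sup>2" using J_equiv by blast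
  \<comment> \<open>Chosen so that \<open>M\<close> times the dissipation of one energy dominates (2
    + 8K + 2K^2 \<alpha>^2) |u_k|^2, a common bound for the coefficients of |u_1|^2, |u_4|^2 and
    |u_5|^2 left over in the derivative of \<open>g\<close>.\<close>
  define M where "M = (2 + 8 * K + 2 * K\<^sup>2 * \<alpha>\<^sup>2) / (2 * \<beta>)"
  have M: "M > 0" using K(1) beta by (simp add: M_def add_pos_nonneg add_pos_pos)
  have betaM: "2 * \<beta> * M = 2 + 8 * K + 2 * K\<^sup>2 * \<alpha>\<^sup>2" using beta by (simp add: M_def)
  define C where "C = (2 + b / 2 + 4 * K * (1 + b / 2 + 2 * \<bar>\<alpha>\<bar>)) * KJ + 3 * M"
  have C: "C > 0" using b K(1) KJ(1) M alpha(1) unfolding C_def by (intro add_pos_pos mult_pos_pos) auto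
  have "t * E (T t U) \<le> 2 * C * (\<Sum>k\<le>4. E ((F ^^ k) U))" if U: "U \<in> dom_pow X Dm F 4" and t: "t > 0" for U t
  proof -
    define V where "V = (\<lambda>k. (F ^^ k) U)"
    have VD: "V k \<in> Dm" if "k < 4" for k using dom_pow_Dm[OF U that] by (simp add: V_def)
    have VX: "V k \<in> X" if "k \<le> 4" for k using dom_pow_iterate_X[OF U that] by (simp add: V_def)
    have VF: "F (V k) = V (Suc k)" for k by (simp add: V_def)
    txt \<open>\<open>u k\<close> and \<open>v k\<close> are the \<open>k\<close>-th time derivatives of the two components; \<open>V 5\<close> need not lie in
      the energy space, so the fifth ones are read off from the velocities of \<open>V 4\<close>.\<close>
    define u where "u = (\<lambda>k s. if k = 5 then fst (snd (T s (V 4))) else fst (T s (V k)))"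
    define v where "v = (\<lambda>k s. if k = 5 then snd (snd (snd (T s (V 4)))) else fst (snd (snd (T s (V k)))))"
    have TF: "T s (V (Suc k)) = F (T s (V k))" if "k < 4" "s \<ge> 0" for k s
      using T_F[OF VD[OF that(1)] that(2)] by (simp add: VF)
    have comp: "T s (V k) = (u k s, u (Suc k) s, v k s, v (Suc k) s)" if "k \<le> 4" "s \<ge> 0" for k s
    proof (cases "k = 4")
      case True
      then show ?thesis by (simp add: u_def v_def)
    next
      case False
      then show ?thesis using that TF[of k s] by (cases "T s (V k)") (simp add: u_def v_def F_eq)
    qed
    have dom_k: "u k s \<in> DA1" "v k s \<in> DA2"
      and eq_k: "u (Suc (Suc k)) s = - f1 (u k s) - B (u (Suc k) s) - \<alpha> *\<^sub>R v k s"
        "v (Suc (Suc k)) s = - f2 (v k s) - \<alpha> *\<^sub>R u k s" if k: "k < 4" and s: "s \<ge> 0" for k s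
      using T_Dm[OF VD[OF k] s] TF[OF k s] comp[of k s] comp[of "Suc k" s] k s
      by (auto simp: Dm_iff F_eq)
    have du: "(u k has_vector_derivative u (Suc k) s) (at s within {0..})"
      and dv: "(v k has_vector_derivative v (Suc k) s) (at s within {0..})" if k: "k \<le> 4" and s: "s \<ge> 0" for k s
    proof -
      have *: "((\<lambda>r. fst (T r (V j))) has_vector_derivative u (Suc j) s) (at s within {0..})"
        "((\<lambda>r. fst (snd (T r (V j)))) has_vector_derivative u (Suc (Suc j)) s) (at s within {0..})"
        "((\<lambda>r. fst (snd (snd (T r (V j))))) has_vector_derivative v (Suc j) s) (at s within {0..})"
        "((\<lambda>r. snd (snd (snd (T r (V j))))) has_vector_derivative v (Suc (Suc j)) s) (at s within {0..})"
        if "j < 4" for j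
        using orbit_deriv(1-4)[OF VD[OF that] s] comp[of "Suc j" s] that s by (simp_all add: VF)
      show "(u k has_vector_derivative u (Suc k) s) (at s within {0..})"
      proof (cases "k = 4")
        \<comment> \<open>\<open>V 4\<close> may lie outside the domain, so its orbit cannot be
          differentiated; u_4 is also the velocity of \<open>V 3\<close>, which can.\<close>
        case True
        have "((\<lambda>r. fst (snd (T r (V 3)))) has_vector_derivative u 5 s) (at s within {0..})"
          using *(2)[of 3] by (simp add: eval_nat_numeral)
        moreover have "fst (snd (T r (V 3))) = u 4 r" if "r \<ge> 0" for r
          using comp[of 3 r] that by simp
        ultimately show ?thesis
          using True s has_vector_derivative_transform[of s "{0..}" "u 4" "\<lambda>r. fst (snd (T r (V 3)))"] by simp
      next
        case False
        then show ?thesis using *(1)[of k] k by (simp add: u_def)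
      qed
      show "(v k has_vector_derivative v (Suc k) s) (at s within {0..})"
      proof (cases "k = 4")
        case True
        have "((\<lambda>r. snd (snd (snd (T r (V 3))))) has_vector_derivative v 5 s) (at s within {0..})"
          using *(4)[of 3] by (simp add: eval_nat_numeral)
        moreover have "snd (snd (snd (T r (V 3)))) = v 4 r" if "r \<ge> 0" for r
          using comp[of 3 r] that by simp
        ultimately show ?thesis
          using True s has_vector_derivative_transform[of s "{0..}" "v 4" "\<lambda>r. snd (snd (snd (T r (V 3))))"] by simp
      next
        case False
        then show ?thesis using *(3)[of k] k by (simp add: v_def)
      qed
    qed
    define En where "En = (\<lambda>k s. E (T s (V k)))"
    have dEn: "(En k has_real_derivative - 2 * inner (B (u (Suc k) s)) (u (Suc k) s)) (at s within {0..})"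
      if k: "k \<le> 4" and s: "s \<ge> 0" for k s
    proof (cases k)
      case 0
      then show ?thesis using energy_deriv[OF VD[of 0] s] comp[OF k s] by (simp add: En_def)
    next
      \<comment> \<open>Here \<open>V k\<close> is \<open>F (V j)\<close> with \<open>V j\<close> in
        the domain, so the energy identity for the range applies, including the critical case k =
        4.\<close>
      case (Suc j)
      then show ?thesis using energy_deriv_range[OF VD[of j] s] comp[OF k s] k by (simp add: En_def VF)
    qed
    \<comment> \<open>Primitive obtained by multiplying the first equation by u and the second by v;
      the term with 1/2 integrates the damping against u.\<close>
    define P0 where "P0 = (\<lambda>s. inner (u 1 s) (u 0 s) + inner (v 1 s) (v 0 s) + 1/2 * inner (B (u 0 s)) (u 0 s))"
    \<comment> \<open>Primitive obtained by multiplying the equation for u_5 by u_3. The \<alpha>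
      term has derivative \<alpha> (<v_3, u_3> - <v_1, u_5>), which trades the product that cannot
      be absorbed for one that can.\<close>
    define R where "R = (\<lambda>s. inner (u 4 s) (u 3 s) + 1/2 * inner (B (u 3 s)) (u 3 s)
        + \<alpha> * (inner (v 2 s) (u 3 s) - inner (v 1 s) (u 4 s)))"
    note dB = bounded_linear.has_vector_derivative[OF Bbd]
    have symB: "inner (B x) y = inner (B y) x" for x y using Bsa by (metis inner_commute)
    have dP0: "(P0 has_real_derivative 2 * (norm (u 1 s))\<^sup>2 + 2 * (norm (v 1 s))\<^sup>2 - En 0 s) (at s within {0..})"
      if s: "s \<ge> 0" for s
    proof -
      have "(P0 has_real_derivative
          (inner (u 1 s) (u (Suc 0) s) + inner (u (Suc 1) s) (u 0 s)) + (inner (v 1 s) (v (Suc 0) s) + inner (v (Suc 1) s) (v 0 s))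
          + 1/2 * (inner (B (u 0 s)) (u (Suc 0) s) + inner (B (u (Suc 0) s)) (u 0 s))) (at s within {0..})"
        unfolding P0_def
        by (intro DERIV_add DERIV_cmult has_real_derivative_inner dB du dv s) simp_all
      moreover have "inner (u (Suc 1) s) (u 0 s) = - (norm (s1 (u 0 s)))\<^sup>2 - inner (B (u 1 s)) (u 0 s) - \<alpha> * inner (v 0 s) (u 0 s)"
        "inner (v (Suc 1) s) (v 0 s) = - (norm (s2 (v 0 s)))\<^sup>2 - \<alpha> * inner (u 0 s) (v 0 s)"
        using is_sqrt_op_inner[OF S1, of "u 0 s" "u 0 s"] is_sqrt_op_inner[OF S2, of "v 0 s" "v 0 s"] dom_k[of 0 s] D1(3) D2(3) s
        by (simp_all add: eq_k[of 0 s, simplified] inner_diff_left power2_norm_eq_inner)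
      moreover have "inner (B (u 0 s)) (u 1 s) = inner (B (u 1 s)) (u 0 s)" by (rule symB)
      moreover have "En 0 s = (norm (s1 (u 0 s)))\<^sup>2 + (norm (u 1 s))\<^sup>2 + (norm (s2 (v 0 s)))\<^sup>2 + (norm (v 1 s))\<^sup>2
          + 2 * \<alpha> * inner (u 0 s) (v 0 s)"
        unfolding En_def using comp[of 0 s] s by (simp add: E_eq)
      ultimately show ?thesis
        by (elim DERIV_cong) (simp add: power2_norm_eq_inner inner_commute algebra_simps)
    qed
    have dR: "(R has_real_derivative (norm (u 4 s))\<^sup>2 - (norm (s1 (u 3 s)))\<^sup>2 - \<alpha> * inner (v 1 s) (u 5 s)) (at s within {0..})"
      if s: "s \<ge> 0" for s
    proof -
      have "(R has_real_derivative
          (inner (u 4 s) (u (Suc 3) s) + inner (u (Suc 4) s) (u 3 s))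
          + 1/2 * (inner (B (u 3 s)) (u (Suc 3) s) + inner (B (u (Suc 3) s)) (u 3 s))
          + \<alpha> * ((inner (v 2 s) (u (Suc 3) s) + inner (v (Suc 2) s) (u 3 s)) - (inner (v 1 s) (u (Suc 4) s) + inner (v (Suc 1) s) (u 4 s))))
          (at s within {0..})"
        unfolding R_def
        by (intro DERIV_add DERIV_diff DERIV_cmult has_real_derivative_inner dB du dv s) simp_all
      moreover have [simp]: "Suc 3 = 4" "Suc 4 = 5" "Suc 2 = 3" "Suc (Suc 0) = 2" by simp_all
      moreover have "u 5 s = - f1 (u 3 s) - B (u 4 s) - \<alpha> *\<^sub>R v 3 s" using eq_k(1)[of 3 s] s by simp
      then have "inner (u 5 s) (u 3 s) = - (norm (s1 (u 3 s)))\<^sup>2 - inner (B (u 4 s)) (u 3 s) - \<alpha> * inner (v 3 s) (u 3 s)"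
        using is_sqrt_op_inner[OF S1, of "u 3 s" "u 3 s"] dom_k[of 3 s] D1(3) s
        by (simp add: inner_diff_left power2_norm_eq_inner)
      moreover have "inner (B (u 3 s)) (u 4 s) = inner (B (u 4 s)) (u 3 s)" by (rule symB)
      ultimately show ?thesis
        by (elim DERIV_cong) (simp add: power2_norm_eq_inner inner_commute algebra_simps)
    qed
    txt \<open>Modulo dissipated and absorbed terms, \<open>P0' = - E + 2 |v 1|\<^sup>2\<close> and \<open>R' = - |s1 (u 3)|\<^sup>2\<close>, and the static
      estimate bounds \<open>|v 1|\<^sup>2\<close> by \<open>K |s1 (u 3)|\<^sup>2\<close>; the last summand turns the integral bound on the
      decreasing energy into a pointwise one.\<close>
    define g where "g = (\<lambda>s. P0 s + 4 * K * R s + M * (En 0 s + En 3 s + En 4 s) + s * En 0 s)"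
    have dg: "\<exists>g'. (g has_real_derivative g') (at s within {0..}) \<and> g' \<le> 0" if s: "s \<ge> 0" for s
    proof -
      define n1 n4 n5 nv ns where "n1 = (norm (u 1 s))\<^sup>2" and "n4 = (norm (u 4 s))\<^sup>2"
        and "n5 = (norm (u 5 s))\<^sup>2" and "nv = (norm (v 1 s))\<^sup>2" and "ns = (norm (s1 (u 3 s)))\<^sup>2"
      define D where "D = (\<lambda>k. inner (B (u k s)) (u k s))"
      have pos: "n1 \<ge> 0" "n4 \<ge> 0" "n5 \<ge> 0" by (auto simp: n1_def n4_def n5_def)
      have "(g has_real_derivative (2 * n1 + 2 * nv - En 0 s) + 4 * K * (n4 - ns - \<alpha> * inner (v 1 s) (u 5 s))
          + M * ((- 2 * D (Suc 0)) + (- 2 * D (Suc 3)) + (- 2 * D (Suc 4))) + (1 * En 0 s + (- 2 * D (Suc 0)) * s)) (at s within {0..})"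
        unfolding g_def n1_def n4_def n5_def nv_def ns_def D_def
        by (intro DERIV_add DERIV_cmult DERIV_mult DERIV_ident dP0 dR dEn s) simp_all
      moreover have "(2 * n1 + 2 * nv - En 0 s) + 4 * K * (n4 - ns - \<alpha> * inner (v 1 s) (u 5 s))
          + M * ((- 2 * D (Suc 0)) + (- 2 * D (Suc 3)) + (- 2 * D (Suc 4))) + (1 * En 0 s + (- 2 * D (Suc 0)) * s) \<le> 0"
      proof -
        have Dlow: "\<beta> * (norm (u k s))\<^sup>2 \<le> D k" for k using Bcoer by (simp add: D_def)
        have Dpos: "0 \<le> D 1" using Dlow[of 1] beta by (smt (verit) zero_le_mult_iff zero_le_power2)
        have MD: "(2 + 8 * K + 2 * K\<^sup>2 * \<alpha>\<^sup>2) * (norm (u k s))\<^sup>2 \<le> 2 * (M * D k)" for k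
          unfolding betaM[symmetric] using mult_left_mono[OF Dlow[of k], of "2 * M"] M by (simp add: mult_ac)
        have "nv \<le> K * (n5 + n4 + n1 + ns)"
          using K(2) dom_k[of 1 s] dom_k[of 3 s] eq_k(2)[of 1 s] eq_k(1)[of 3 s] s
          unfolding nv_def n5_def n4_def n1_def ns_def by (simp add: eval_nat_numeral)
        then have V: "nv \<le> K * n5 + K * n4 + K * n1 + K * ns" by (simp add: algebra_simps)
        have "\<bar>\<alpha> * inner (v 1 s) (u 5 s)\<bar> \<le> \<bar>\<alpha>\<bar> * (norm (v 1 s) * norm (u 5 s))"
          unfolding abs_mult by (intro mult_left_mono Cauchy_Schwarz_ineq2) auto
        then have "K * \<bar>\<alpha> * inner (v 1 s) (u 5 s)\<bar> \<le> norm (v 1 s) * (K * \<bar>\<alpha>\<bar> * norm (u 5 s))"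
          using mult_left_mono[of _ _ K] K(1) by (fastforce simp: mult_ac)
        moreover have "2 * (norm (v 1 s) * (K * \<bar>\<alpha>\<bar> * norm (u 5 s))) \<le> nv + K\<^sup>2 * \<alpha>\<^sup>2 * n5"
          using sum_squares_bound[of "norm (v 1 s)" "K * \<bar>\<alpha>\<bar> * norm (u 5 s)"]
          by (simp add: nv_def n5_def power_mult_distrib mult.assoc)
        moreover have "- (K * (\<alpha> * inner (v 1 s) (u 5 s))) \<le> K * \<bar>\<alpha> * inner (v 1 s) (u 5 s)\<bar>"
          using mult_left_mono[of "- (\<alpha> * inner (v 1 s) (u 5 s))" "\<bar>\<alpha> * inner (v 1 s) (u 5 s)\<bar>" K] K(1) by simp
        ultimately have X5: "- (4 * K * (\<alpha> * inner (v 1 s) (u 5 s))) \<le> 2 * nv + 2 * (K\<^sup>2 * \<alpha>\<^sup>2 * n5)" by linarith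
        have M1: "2 * n1 + 8 * (K * n1) + 2 * (K\<^sup>2 * \<alpha>\<^sup>2 * n1) \<le> 2 * (M * D 1)"
          and M4: "2 * n4 + 8 * (K * n4) + 2 * (K\<^sup>2 * \<alpha>\<^sup>2 * n4) \<le> 2 * (M * D 4)"
          and M5: "2 * n5 + 8 * (K * n5) + 2 * (K\<^sup>2 * \<alpha>\<^sup>2 * n5) \<le> 2 * (M * D 5)"
          using MD[of 1] MD[of 4] MD[of 5] by (simp_all add: n1_def n4_def n5_def algebra_simps)
        have nn: "0 \<le> K * n1" "0 \<le> K * n4" "0 \<le> K * n5" "0 \<le> K\<^sup>2 * \<alpha>\<^sup>2 * n1" "0 \<le> K\<^sup>2 * \<alpha>\<^sup>2 * n4" "0 \<le> K\<^sup>2 * \<alpha>\<^sup>2 * n5"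
          "0 \<le> D 1 * s"
          using pos K(1) Dpos s by simp_all
        have "(2 * n1 + 2 * nv - En 0 s) + 4 * K * (n4 - ns - \<alpha> * inner (v 1 s) (u 5 s))
          + M * ((- 2 * D (Suc 0)) + (- 2 * D (Suc 3)) + (- 2 * D (Suc 4))) + (1 * En 0 s + (- 2 * D (Suc 0)) * s)
          = 2 * n1 + 2 * nv + 4 * (K * n4) - 4 * (K * ns) - 4 * K * (\<alpha> * inner (v 1 s) (u 5 s))
            - 2 * (M * D 1) - 2 * (M * D 4) - 2 * (M * D 5) - 2 * (D 1 * s)"
          by (simp add: algebra_simps eval_nat_numeral)
        \<comment> \<open>The term \<open>nv\<close> occurs four times, twice from \<open>P0\<close>
          and twice from \<open>X5\<close>. Inserting \<open>V\<close> gives 4 K \<open>ns\<close>,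
          which the weight 4 K of \<open>R\<close> cancels exactly. The coefficients left at
          \<open>n1\<close>, \<open>n4\<close>, \<open>n5\<close> are 2 + 4K, 8K and 4K + 2K^2
          \<alpha>^2.\<close>
        also have "\<dots> \<le> 0" using V X5 M1 M4 M5 nn pos by linarith
        finally show ?thesis .
      qed
      ultimately show ?thesis by blast
    qed
    \<comment> \<open>At 0 the derivative is one-sided, so monotonicity uses derivatives in the open
      interval and continuity up to the ends.\<close>
    have "g t \<le> g 0"
    proof (rule DERIV_nonpos_imp_decreasing_open[where f = g])
      show "0 \<le> t" using t by simp
      show "\<exists>y. DERIV g s :> y \<and> y \<le> 0" if "0 < s" "s < t" for s
        using dg[of s] that at_within_interior[of s "{0..}"] by (simp add: interior_real_atLeast)
      show "continuous_on {0..t} g"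
      proof (rule continuous_on_subset)
        show "continuous_on {0..} g"
          unfolding continuous_on_eq_continuous_within using dg DERIV_continuous by fastforce
      qed auto
    qed
    define N where "N = (\<Sum>k\<le>4. E ((F ^^ k) U))"
    have Pb: "\<bar>P0 s + 4 * K * R s + M * (En 0 s + En 3 s + En 4 s)\<bar> \<le> C * N" if s: "s \<ge> 0" for s
    proof -
      have EnX: "0 \<le> En k s" "En k s \<le> E (V k)" "(norm (J (T s (V k))))\<^sup>2 \<le> KJ * En k s" if "k \<le> 4" for k
        using E_nonneg[OF T_X[OF s VX[OF that]]] E_T_le[OF s VX[OF that]] KJ(2)[OF T_X[OF s VX[OF that]]]
        by (auto simp: En_def)
      have EN: "E (V k) \<le> N" if "k \<le> 4" for k
        using member_le_sum[of k "{..4}" "\<lambda>k. E (V k)"] that E_nonneg VX by (simp add: N_def V_def)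
      define Z where "Z = KJ * N"
      have comp_le: "(norm (u k s))\<^sup>2 \<le> Z" "(norm (v k s))\<^sup>2 \<le> Z" if "k \<le> 4" for k
      proof -
        have "En k s \<le> N" using EnX(2)[OF that] EN[OF that] by linarith
        then have "(norm (J (T s (V k))))\<^sup>2 \<le> Z"
          using order_trans[OF EnX(3)[OF that]] KJ(1) by (simp add: Z_def)
        then show "(norm (u k s))\<^sup>2 \<le> Z" "(norm (v k s))\<^sup>2 \<le> Z"
          unfolding comp[OF that s] norm_J by (smt (verit) zero_le_power2)+
      qed
      have ip: "\<bar>inner x y\<bar> \<le> Z" if "(norm x)\<^sup>2 \<le> Z" "(norm y)\<^sup>2 \<le> Z" for x y :: 'a
        using abs_inner_le_sum_sq[of x y] that by argo
      have ipB: "\<bar>inner (B (u k s)) (u k s)\<bar> \<le> b * Z" if "k \<le> 4" for k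
      proof -
        have "\<bar>inner (B (u k s)) (u k s)\<bar> \<le> norm (B (u k s)) * norm (u k s)" by (rule Cauchy_Schwarz_ineq2)
        also have "\<dots> \<le> (b * norm (u k s)) * norm (u k s)" by (intro mult_right_mono b) auto
        also have "\<dots> = b * (norm (u k s))\<^sup>2" by (simp add: power2_eq_square)
        also have "\<dots> \<le> b * Z" using comp_le[OF that] b(1) by simp
        finally show ?thesis .
      qed
      have P0b: "\<bar>P0 s\<bar> \<le> (2 + b / 2) * Z"
        using ip[OF comp_le(1)[of 1] comp_le(1)[of 0]] ip[OF comp_le(2)[of 1] comp_le(2)[of 0]] ipB[of 0]
        unfolding P0_def by (simp add: algebra_simps)
      have "\<bar>inner (v 2 s) (u 3 s) - inner (v 1 s) (u 4 s)\<bar> \<le> 2 * Z"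
        using ip[OF comp_le(2)[of 2] comp_le(1)[of 3]] ip[OF comp_le(2)[of 1] comp_le(1)[of 4]] by simp
      then have "\<bar>\<alpha> * (inner (v 2 s) (u 3 s) - inner (v 1 s) (u 4 s))\<bar> \<le> \<bar>\<alpha>\<bar> * (2 * Z)"
        unfolding abs_mult by (intro mult_left_mono) auto
      then have "\<bar>R s\<bar> \<le> (1 + b / 2 + 2 * \<bar>\<alpha>\<bar>) * Z"
        using ip[OF comp_le(1)[of 4] comp_le(1)[of 3]] ipB[of 3]
        unfolding R_def by (simp add: algebra_simps)
      then have "\<bar>4 * K * R s\<bar> \<le> 4 * K * ((1 + b / 2 + 2 * \<bar>\<alpha>\<bar>) * Z)"
        using K(1) by (simp add: abs_mult)
      moreover have "\<bar>M * (En 0 s + En 3 s + En 4 s)\<bar> \<le> M * (3 * N)"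
        using EnX[of 0] EnX[of 3] EnX[of 4] EN[of 0] EN[of 3] EN[of 4] M by (simp add: abs_mult)
      moreover have "C * N = (2 + b / 2) * Z + 4 * K * ((1 + b / 2 + 2 * \<bar>\<alpha>\<bar>) * Z) + M * (3 * N)"
        by (simp add: C_def Z_def algebra_simps)
      ultimately show ?thesis using P0b by linarith
    qed
    \<comment> \<open>The weighted summand of \<open>g\<close> vanishes at time 0; bounding the rest
      of \<open>g\<close> at both times 0 and t produces the factor 2.\<close>
    have "t * En 0 t \<le> 2 * (C * N)"
      using \<open>g t \<le> g 0\<close> Pb[of 0] Pb[of t] t unfolding g_def by simp
    then show ?thesis by (simp add: En_def V_def N_def)
  qed
  then show thesis using that[of "2 * C"] C by simp
qed


text \<open>Halving the time interval: the one-step estimate on the second half is applied to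
  \<open>T s U\<close>, and each of its five energies has already decayed at rate s^(-n) on the
  first half by the induction hypothesis for A^j U, j <= 4. This accounts for the factors 5 and
  2^(n+1).\<close>

lemma polynomial_decay:
  "\<exists>C>0. \<forall>U t. U \<in> dom_pow X Dm F (4 * n) \<longrightarrow> t > 0 \<longrightarrow>
     t ^ n * E (T t U) \<le> C * (\<Sum>k\<le>4 * n. E ((F ^^ k) U))"
proof (induction n)
  case 0
  have "t ^ 0 * E (T t U) \<le> 1 * (\<Sum>k\<le>4 * 0. E ((F ^^ k) U))" if "U \<in> X" "t > 0" for U t
    using E_T_le[of t U] that by simp
  then show ?case by (intro exI[of _ 1]) simp
next
  case (Suc n)
  then obtain C1 where C1: "C1 > 0"
    "\<And>U t. U \<in> dom_pow X Dm F (4 * n) \<Longrightarrow> t > 0 \<Longrightarrow> t ^ n * E (T t U) \<le> C1 * (\<Sum>k\<le>4 * n. E ((F ^^ k) U))"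
    by blast
  obtain C where C: "C > 0"
    "\<And>U t. U \<in> dom_pow X Dm F 4 \<Longrightarrow> t > 0 \<Longrightarrow> t * E (T t U) \<le> C * (\<Sum>k\<le>4. E ((F ^^ k) U))"
    using polynomial_decay_step by blast
  have "t ^ Suc n * E (T t U) \<le> (2 ^ Suc n * C * (5 * C1)) * (\<Sum>k\<le>4 * Suc n. E ((F ^^ k) U))"
    if U: "U \<in> dom_pow X Dm F (4 * Suc n)" and t: "t > 0" for U t
  proof -
    define s where "s = t / 2"
    have s: "s > 0" "t = s + s" using t by (auto simp: s_def)
    define N where "N = (\<Sum>k\<le>4 * Suc n. E ((F ^^ k) U))"
    have U4: "U \<in> dom_pow X Dm F (4 + 4 * n)" using U by simp
    have nonneg: "0 \<le> E ((F ^^ k) U)" if "k \<le> 4 * Suc n" for k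
      using E_nonneg dom_pow_iterate_X[OF U that] by blast
    have step: "s ^ n * E (T s ((F ^^ j) U)) \<le> C1 * N" if j: "j \<le> 4" for j
    proof -
      \<comment> \<open>Of the 4 + 4n available powers, j are spent on A^j U and 4 - j are
        discarded, which leaves the 4n required by the induction hypothesis.\<close>
      have "U \<in> dom_pow X Dm F (j + (4 * n + (4 - j)))" using U4 j by (simp add: add.commute)
      then have Uj: "(F ^^ j) U \<in> dom_pow X Dm F (4 * n)" by (intro dom_pow_mono[OF dom_pow_add])
      have "(\<Sum>k\<le>4 * n. E ((F ^^ k) ((F ^^ j) U))) = (\<Sum>k\<le>4 * n. E ((F ^^ (k + j)) U))"
        by (simp add: funpow_add)
      also have "\<dots> = (\<Sum>i\<in>(\<lambda>k. k + j) ` {..4 * n}. E ((F ^^ i) U))"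
        by (subst sum.reindex) (auto simp: inj_on_def)
      also have "\<dots> \<le> N"
        unfolding N_def using j nonneg by (intro sum_mono2) auto
      finally show ?thesis
        using C1(2)[OF Uj s(1)] mult_left_mono[of _ N C1] C1(1) by (meson less_imp_le order_trans)
    qed
    have X: "U \<in> X" using U by (rule dom_pow_X)
    have Us: "T s U \<in> dom_pow X Dm F 4"
      using dom_pow_T[OF dom_pow_mono[OF U4], of s] s by simp
    have "s ^ Suc n * E (T t U) = s ^ n * (s * E (T s (T s U)))"
      unfolding s(2) using T_plus[of s s U] s(1) X by simp
    also have "\<dots> \<le> s ^ n * (C * (\<Sum>k\<le>4. E ((F ^^ k) (T s U))))"
      using C(2)[OF Us s(1)] s(1) by (intro mult_left_mono) auto
    also have "\<dots> = C * (\<Sum>k\<le>4. s ^ n * E (T s ((F ^^ k) U)))"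
      using funpow_T[OF U, of _ s] s(1) by (simp add: sum_distrib_left mult.left_commute)
    also have "\<dots> \<le> C * (\<Sum>k\<le>4::nat. C1 * N)"
      using C(1) step by (intro mult_left_mono sum_mono) auto
    also have "\<dots> = C * (5 * C1) * N" by simp
    finally have "2 ^ Suc n * (s ^ Suc n * E (T t U)) \<le> 2 ^ Suc n * (C * (5 * C1) * N)"
      by (rule mult_left_mono) simp
    moreover have "t ^ Suc n = 2 ^ Suc n * s ^ Suc n" by (simp add: s_def power_mult_distrib[symmetric])
    ultimately show ?thesis by (simp add: N_def mult_ac)
  qed
  then show ?case using C(1) C1(1) by (intro exI[of _ "2 ^ Suc n * C * (5 * C1)"] conjI allI impI) simp_all
qed

section \<open>Passage to interpolated data\<close>

lemma E_add_le:
  assumes "U \<in> X" "V \<in> X"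
  shows "E (U + V) \<le> 2 * E U + 2 * E V"
proof -
  obtain u p v q u' p' v' q' where UV: "U = (u, p, v, q)" "V = (u', p', v', q')" by (cases U, cases V)
  have "E (U + V) + E (U - V) = 2 * E U + 2 * E V"
    using assms unfolding UV X_iff
    by (simp add: lin1(6,7) lin2(6,7) hinner_def inner_add_left inner_add_right inner_diff_left inner_diff_right algebra_simps)
  then show ?thesis using E_nonneg[OF X_subspace(3)[OF assms]] by linarith
qed

text \<open>Supplies the splitting x = x + 0, so that the infimum defining the K-functional runs
  over a nonempty set and can be bounded from below.\<close>

lemma zero_in_dom_pow: "0 \<in> dom_pow X Dm F k"
proof (induction k)
  case (Suc k)
  have "F 0 = 0"
    using linear_0[OF bounded_linear.linear[OF Bbd]] D1(4)[of 0] D2(4)[of 0] Dm_subspace(1) lin1(5) lin2(5)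
    by (simp add: zero_prod_def F_eq Dm_iff)
  then show ?case using Suc Dm_subspace(1) by simp
qed (simp add: X_subspace)

lemma graph_norm_sq:
  assumes "U \<in> dom_pow X Dm F k"
  shows "(graph_norm nm F k U)\<^sup>2 = (\<Sum>i\<le>k. E ((F ^^ i) U))"
proof -
  have "(graph_norm nm F k U)\<^sup>2 = (\<Sum>i\<le>k. (nm ((F ^^ i) U))\<^sup>2)"
    by (simp add: graph_norm_def sum_nonneg)
  also have "\<dots> = (\<Sum>i\<le>k. E ((F ^^ i) U))"
    using dom_pow_iterate_X[OF assms] by (intro sum.cong) (auto simp: nm_sq)
  finally show ?thesis .
qed

lemma graph_norm_nonneg: "0 \<le> graph_norm nm F k U"
  by (simp add: graph_norm_def sum_nonneg)

lemma interpolated_decay: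
  fixes n :: nat
  assumes th: "0 < \<theta>"
  defines "D \<equiv> dom_pow X Dm F (4 * n)" and "nD \<equiv> graph_norm nm F (4 * n)"
  shows "\<exists>C>0. \<forall>U0 \<in> interp_space nm X nD D \<theta>. \<forall>t>0.
    (nm (T t U0))\<^sup>2 \<le> C / t powr (real n * \<theta>) * (interp_norm nm X nD D \<theta> U0)\<^sup>2"
proof -
  obtain C where C: "C > 0"
    "\<And>U t. U \<in> D \<Longrightarrow> t > 0 \<Longrightarrow> t ^ n * E (T t U) \<le> C * (\<Sum>k\<le>4 * n. E ((F ^^ k) U))"
    using polynomial_decay[of n] unfolding D_def by blast
  have "(nm (T t U0))\<^sup>2 \<le> (4 * \<theta> * C powr \<theta>) / t powr (real n * \<theta>) * (interp_norm nm X nD D \<theta> U0)\<^sup>2"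
    if U0: "U0 \<in> interp_space nm X nD D \<theta>" and t: "t > 0" for U0 t
  proof -
    have X: "U0 \<in> X" and fin: "interp_int nm X nD D \<theta> U0 < \<infinity>"
      using U0 by (auto simp: interp_space_def)
    have TX: "T t U0 \<in> X" using T_X X t by simp
    \<comment> \<open>The parameter at which r |b|, in the graph norm, matches the decay bound for
      the regular part b at time t; every \<tau> >= r is then large enough.\<close>
    define r where "r = sqrt (C / t ^ n)"
    have r: "r > 0" "r\<^sup>2 = C / t ^ n" using C(1) t by (simp_all add: r_def)
    \<comment> \<open>The division by 2 compensates the factor 2 in \<open>E_add_le\<close>.\<close>
    define N where "N = sqrt (E (T t U0) / 2)"
    have N: "N \<ge> 0" "2 * N\<^sup>2 = E (T t U0)" using E_nonneg[OF TX] by (simp_all add: N_def)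
    have Nle: "N \<le> nm a + \<tau> * nD b" if a: "a \<in> X" and b: "b \<in> D" and ab: "U0 = a + b" and tau: "r \<le> \<tau>" for a b \<tau>
    proof -
      have bX: "b \<in> X" using b dom_pow_X unfolding D_def by blast
      have nDb: "0 \<le> nD b" "(nD b)\<^sup>2 = (\<Sum>k\<le>4 * n. E ((F ^^ k) b))"
        using graph_norm_sq[of b "4 * n"] graph_norm_nonneg b unfolding nD_def D_def by blast+
      have "E (T t U0) \<le> 2 * E (T t a) + 2 * E (T t b)"
        unfolding ab using t a bX T_add[of t a b] T_X E_add_le by simp
      moreover have "E (T t a) \<le> (nm a)\<^sup>2" using E_T_le a t nm_sq by simp
      moreover have "E (T t b) \<le> r\<^sup>2 * (nD b)\<^sup>2"
        using C(2)[OF b t] t unfolding nDb(2) r(2) by (simp add: field_simps)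
      moreover have "r\<^sup>2 * (nD b)\<^sup>2 \<le> (\<tau> * nD b)\<^sup>2"
        unfolding power_mult_distrib using r(1) tau by (intro mult_right_mono power_mono) auto
      moreover have "(nm a)\<^sup>2 + (\<tau> * nD b)\<^sup>2 \<le> (nm a + \<tau> * nD b)\<^sup>2"
        using nm_nonneg[OF a] nDb(1) tau r(1) by (simp add: power2_sum)
      ultimately have "N\<^sup>2 \<le> (nm a + \<tau> * nD b)\<^sup>2" using N(2) by linarith
      then show ?thesis
        by (rule power2_le_imp_le) (use nm_nonneg[OF a] nDb(1) tau r(1) in auto)
    qed
    have "N \<le> Kfun nm X nD D \<tau> U0" if "r \<le> \<tau>" for \<tau>
      unfolding Kfun_def
    proof (rule cInf_greatest)
      show "{nm a + \<tau> * nD b |a b. a \<in> X \<and> b \<in> D \<and> U0 = a + b} \<noteq> {}"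
      proof -
        have "nm U0 + \<tau> * nD 0 \<in> {nm a + \<tau> * nD b |a b. a \<in> X \<and> b \<in> D \<and> U0 = a + b}"
          unfolding mem_Collect_eq D_def using X zero_in_dom_pow
          by (intro exI[of _ U0] exI[of _ 0] conjI) (simp_all only: add_0_right)
        then show ?thesis by blast
      qed
    qed (use Nle that in blast)
    from interp_norm_lower_bound[OF th r(1) N(1) this fin]
    have "E (T t U0) \<le> 4 * \<theta> * r powr (2 * \<theta>) * (interp_norm nm X nD D \<theta> U0)\<^sup>2"
      using N(2) by simp
    moreover have "r powr (2 * \<theta>) = (r\<^sup>2) powr \<theta>"
      using r(1) by (simp add: powr_powr powr_numeral[symmetric] del: powr_numeral)
    then have "r powr (2 * \<theta>) = C powr \<theta> / t powr (real n * \<theta>)"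
      unfolding r(2) using C(1) t by (simp add: powr_divide powr_powr powr_realpow[symmetric])
    ultimately show ?thesis using nm_sq[OF TX] by simp
  qed
  then show ?thesis using C(1) th by (intro exI[of _ "4 * \<theta> * C powr \<theta>"]) simp
qed

end

theorem theorem4p1:
  fixes DA1 DA2 DS1 DS2 :: "'a::{real_inner, complete_space} set"
    and f1 f2 s1 s2 B :: "'a \<Rightarrow> 'a"
    and \<omega>1 \<omega>2 \<beta> \<alpha> c \<theta> :: real
    and n :: nat
    and T :: "real \<Rightarrow> 'a \<times> 'a \<times> 'a \<times> 'a \<Rightarrow> 'a \<times> 'a \<times> 'a \<times> 'a"
  assumes A1: "dcsa_op DA1 f1" and A2: "dcsa_op DA2 f2"
    and om1: "\<omega>1 > 0" and om2: "\<omega>2 > 0"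
    and coer1: "\<forall>u\<in>DA1. inner (f1 u) u \<ge> \<omega>1 * (norm u)\<^sup>2"
    and coer2: "\<forall>u\<in>DA2. inner (f2 u) u \<ge> \<omega>2 * (norm u)\<^sup>2"
    and S1: "is_sqrt_op DA1 f1 DS1 s1" and S2: "is_sqrt_op DA2 f2 DS2 s2"
    and Bbd: "bounded_linear B"
    and Bsa: "\<forall>u v. inner (B u) v = inner u (B v)"
    and beta: "\<beta> > 0" and Bcoer: "\<forall>u. inner (B u) u \<ge> \<beta> * (norm u)\<^sup>2"
    and alpha: "0 < \<bar>\<alpha>\<bar>" "\<bar>\<alpha>\<bar> < sqrt (\<omega>1 * \<omega>2)"
    and sg: "is_C0_semigroup_gen (hnorm s1 s2 \<alpha>) (Hcar DS1 DS2) (DopA DA1 DS1 DA2 DS2)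
               (opA f1 f2 B \<alpha>) T"
    and dom: "DA2 \<subseteq> DS1"
    and cpos: "c > 0" and cbound: "\<forall>u\<in>DA2. norm (s1 u) \<le> c * norm (f2 u)"
    and n: "n \<ge> 1" and th: "0 < \<theta>" "\<theta> < 1"
  shows "\<exists>C>0. \<forall>U0 \<in> interp_space (hnorm s1 s2 \<alpha>) (Hcar DS1 DS2)
              (graph_norm (hnorm s1 s2 \<alpha>) (opA f1 f2 B \<alpha>) (4 * n))
              (dom_pow (Hcar DS1 DS2) (DopA DA1 DS1 DA2 DS2) (opA f1 f2 B \<alpha>) (4 * n)) \<theta>.
           \<forall>t>0. (hnorm s1 s2 \<alpha> (T t U0))\<^sup>2 \<le> C / t powr (real n * \<theta>) *
             (interp_norm (hnorm s1 s2 \<alpha>) (Hcar DS1 DS2)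
              (graph_norm (hnorm s1 s2 \<alpha>) (opA f1 f2 B \<alpha>) (4 * n))
              (dom_pow (Hcar DS1 DS2) (DopA DA1 DS1 DA2 DS2) (opA f1 f2 B \<alpha>) (4 * n)) \<theta> U0)\<^sup>2"
proof -
  interpret weakly_coupled_system DA1 DA2 DS1 DS2 f1 f2 s1 s2 B \<omega>1 \<omega>2 \<beta> \<alpha> T c
    by (intro weakly_coupled_system.intro coupled_system.intro weakly_coupled_system_axioms.intro) (fact assms)+
  show ?thesis using interpolated_decay[OF th(1)] by blast
qed

end
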